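(* Let $a,b>0$ and let $\Omega_{a,b}:=\{x+iy\in\mathbb{C}:x^2/a^2+y^2/b^2\le1\}$. Then $$c(\Omega_{a,b})=\frac{2}{\pi}\arctan\Bigl(\frac12\Bigl|\frac ba-\frac ab\Bigr|\Bigr).$$
   Context: The configuration constant $c(\Omega)$ of a compact convex set $\Omega\subset\mathbb{C}$ with non-empty interior is defined as follows. The boundary $\partial\Omega$ is a rectifiable simple closed curve, oriented counter-clockwise; $s$ denotes arclength measure on $\partial\Omega$. At every $\zeta\in\partial\Omega$ the one-sided tangent angles $\alpha_-(\zeta)\le\alpha_+(\zeta)$ (incoming and outgoing, with branches chosen so that $0\le\alpha_+(\zeta)-\alpha_-(\zeta)<\pi$) exist; $\zeta$ is called a corner if $\alpha_-(\zeta)<\alpha_+(\zeta)$, and there are at most countably many corners. Put $\theta_\zeta:=\pi-\alpha_+(\zeta)+\alpha_-(\zeta)\in(0,\pi]$ (the interior angle at $\zeta$; it equals $\pi$ if $\zeta$ is not a corner). At a non-corner $\sigma$ let $T(\sigma)$ be the unit tangent (in the positive direction) and $N(\sigma)=-iT(\sigma)$ the outward unit normal. For $\zeta\in\partial\Omega$ let $\mu_\zeta$ be the Borel probability measure on $\partial\Omega$ given by $d\mu_\zeta=(1-\theta_\zeta/\pi)\,d\delta_\zeta+\rho_\zeta\,ds$, where $\delta_\zeta$ is the unit point mass at $\zeta$ and $\rho_\zeta(\sigma)=\frac1\pi\operatorname{Re}\Big(\frac{N(\sigma)}{\sigma-\zeta}\Big)$ for non-corners $\sigma\ne\zeta$.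 Let $C(\partial\Omega)$ be the space of complex-valued continuous functions on $\partial\Omega$. The Neumann–Poincaré operator $K_\Omega:C(\partial\Omega)\to C(\partial\Omega)$ is $K_\Omega f(\zeta):=\int_{\partial\Omega}f\,d\mu_\zeta$, $\zeta\in\partial\Omega$; it fixes the constant function $\mathbf{1}$, so it acts on $C(\partial\Omega)/\mathbb{C}\mathbf{1}$, which has the quotient norm $\|g+\mathbb{C}\mathbf{1}\|=\min_{\lambda\in\mathbb{C}}\max_{\zeta\in\partial\Omega}|g(\zeta)-\lambda|$. The configuration constant $c(\Omega)$ is the operator norm of $K_\Omega$ on $C(\partial\Omega)/\mathbb{C}\mathbf{1}$. *)

theory Defs
  imports "HOL-Analysis.Analysis" "HOL-Complex_Analysis.Winding_Numbers"
begin

(* Throughout, Omega is meant to be a compact convex subset of the complex plane with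
   non-empty interior; the constants below have their intended meaning for such sets only. *)

definition curve_length :: "(real \<Rightarrow> complex) \<Rightarrow> real \<Rightarrow> real \<Rightarrow> ennreal" where
  "curve_length \<gamma> a b =
     (SUP (n, t) \<in> {(n::nat, t::nat \<Rightarrow> real). mono t \<and> range t \<subseteq> {a..b}}.
        ennreal (\<Sum>i<n. dist (\<gamma> (t i)) (\<gamma> (t (Suc i)))))"

(* A counter-clockwise parametrization of the boundary by arclength, extended to the whole
   real line with the perimeter L as its period. *)
definition arclength_param :: "complex set \<Rightarrow> real \<Rightarrow> (real \<Rightarrow> complex) \<Rightarrow> bool" where
  "arclength_param \<Omega> L \<gamma> \<longleftrightarrow>
     L > 0 \<and>
     (\<forall>s. \<gamma> (s + L) = \<gamma> s) \<and>
     inj_on \<gamma> {0..<L} \<and>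
     \<gamma> ` {0..<L} = frontier \<Omega> \<and>
     (\<forall>s t. s \<le> t \<longrightarrow> curve_length \<gamma> s t = ennreal (t - s)) \<and>
     (\<forall>z\<in>interior \<Omega>. winding_number (\<lambda>t. \<gamma> (L * t)) z = 1)"

(* L is determined by Omega, and gamma is determined up to a shift of its argument;
   nothing defined below depends on that shift. *)
definition perimeter :: "complex set \<Rightarrow> real" where
  "perimeter \<Omega> = (SOME L. \<exists>\<gamma>. arclength_param \<Omega> L \<gamma>)"

definition bdry :: "complex set \<Rightarrow> real \<Rightarrow> complex" where
  "bdry \<Omega> = (SOME \<gamma>. arclength_param \<Omega> (perimeter \<Omega>) \<gamma>)"

definition bdry_pos :: "complex set \<Rightarrow> complex \<Rightarrow> real" where
  "bdry_pos \<Omega> = inv_into {0..<perimeter \<Omega>} (bdry \<Omega>)"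

definition arclength_measure :: "complex set \<Rightarrow> complex measure" where
  "arclength_measure \<Omega> =
     distr (restrict_space lborel {0..<perimeter \<Omega>}) (restrict_space borel (frontier \<Omega>)) (bdry \<Omega>)"

(* By convexity the one-sided derivatives of the arclength parametrization exist everywhere
   and are unit vectors. *)
definition tangent_in :: "complex set \<Rightarrow> complex \<Rightarrow> complex" where
  "tangent_in \<Omega> \<zeta> = vector_derivative (bdry \<Omega>) (at (bdry_pos \<Omega> \<zeta>) within {..bdry_pos \<Omega> \<zeta>})"

definition tangent_out :: "complex set \<Rightarrow> complex \<Rightarrow> complex" where
  "tangent_out \<Omega> \<zeta> = vector_derivative (bdry \<Omega>) (at (bdry_pos \<Omega> \<zeta>) within {bdry_pos \<Omega> \<zeta>..})"

definition alpha_minus :: "complex set \<Rightarrow> complex \<Rightarrow> real" where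
  "alpha_minus \<Omega> \<zeta> = Arg (tangent_in \<Omega> \<zeta>)"

(* The branch of the outgoing angle is the one with
   0 <= alpha_plus - alpha_minus < 2 * pi; by convexity the difference is then less than pi. *)
definition alpha_plus :: "complex set \<Rightarrow> complex \<Rightarrow> real" where
  "alpha_plus \<Omega> \<zeta> = alpha_minus \<Omega> \<zeta> + Arg2pi (tangent_out \<Omega> \<zeta> / tangent_in \<Omega> \<zeta>)"

definition corner :: "complex set \<Rightarrow> complex \<Rightarrow> bool" where
  "corner \<Omega> \<zeta> \<longleftrightarrow> alpha_minus \<Omega> \<zeta> < alpha_plus \<Omega> \<zeta>"

definition interior_angle :: "complex set \<Rightarrow> complex \<Rightarrow> real" where
  "interior_angle \<Omega> \<zeta> = pi - alpha_plus \<Omega> \<zeta> + alpha_minus \<Omega> \<zeta>"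

definition outward_normal :: "complex set \<Rightarrow> complex \<Rightarrow> complex" where
  "outward_normal \<Omega> \<sigma> = - \<i> * tangent_out \<Omega> \<sigma>"

(* The value 0 at sigma = zeta and at corners is immaterial: these points form a countable
   set, which is null for arclength. *)
definition NP_density :: "complex set \<Rightarrow> complex \<Rightarrow> complex \<Rightarrow> real" where
  "NP_density \<Omega> \<zeta> \<sigma> =
     (if \<sigma> = \<zeta> \<or> corner \<Omega> \<sigma> then 0
      else 1 / pi * Re (outward_normal \<Omega> \<sigma> / (\<sigma> - \<zeta>)))"

definition NP_measure :: "complex set \<Rightarrow> complex \<Rightarrow> complex measure" where
  "NP_measure \<Omega> \<zeta> =
     measure_of (frontier \<Omega>) (sets (restrict_space borel (frontier \<Omega>)))
       (\<lambda>A. ennreal (1 - interior_angle \<Omega> \<zeta> / pi) * indicator A \<zeta>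
          + (\<integral>\<^sup>+\<sigma>\<in>A. ennreal (NP_density \<Omega> \<zeta> \<sigma>) \<partial>arclength_measure \<Omega>))"

definition NP_operator :: "complex set \<Rightarrow> (complex \<Rightarrow> complex) \<Rightarrow> complex \<Rightarrow> complex" where
  "NP_operator \<Omega> f \<zeta> = (\<integral>\<sigma>. f \<sigma> \<partial>NP_measure \<Omega> \<zeta>)"

(* The norm of the coset of g in the quotient of the continuous functions on the boundary by
   the constants. *)
definition quotient_norm :: "complex set \<Rightarrow> (complex \<Rightarrow> complex) \<Rightarrow> real" where
  "quotient_norm \<Omega> g = (INF c::complex. SUP \<zeta>\<in>frontier \<Omega>. norm (g \<zeta> - c))"

(* Elements of the quotient are given by representatives: complex functions that are
   continuous on the boundary. Values off the boundary play no role. *)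
definition configuration_constant :: "complex set \<Rightarrow> real" where
  "configuration_constant \<Omega> =
     (SUP f \<in> {f. continuous_on (frontier \<Omega>) f \<and> quotient_norm \<Omega> f \<le> 1}.
        quotient_norm \<Omega> (NP_operator \<Omega> f))"

definition ellipse :: "real \<Rightarrow> real \<Rightarrow> complex set" where
  "ellipse a b = {z. (Re z)\<^sup>2 / a\<^sup>2 + (Im z)\<^sup>2 / b\<^sup>2 \<le> 1}"

end

theory Submission
  imports Defs
begin

text \<open>Parametrize the boundary by \<open>E t = a cos t + i b sin t\<close>. Since
  \<open>E t - E u = 2 sin ((t - u) / 2) E' ((t + u) / 2)\<close>, the kernel of the operator becomes the Poisson kernel:
  \<open>K f (E u)\<close> is the integral of \<open>f (E t) P (t + u)\<close>, where \<open>P\<close> has radius \<open>(a - b) / (a + b)\<close>. So the norm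
  is at least half the largest \<open>L\<^sup>1\<close> distance of two translates of \<open>P\<close>. This distance is computed from the
  explicit primitive \<open>x / (2 \<pi>) + arctan (r sin x / (1 - r cos x)) / \<pi>\<close>; it is largest for antipodal
  translates. Conversely, if \<open>z\<close> is the centre of the smallest disc enclosing the values of \<open>K f\<close>, its radius is
  a combination of these values whose coefficients have sum 0 and absolute sum at most 1. Such a combination of translates
  of \<open>P\<close> has \<open>L\<^sup>1\<close> norm at most half the largest distance of two translates.\<close>

text \<open>The quotient norm is the radius of the smallest disc enclosing the values of a function.
  Half the oscillation would measure it for real functions, but a planar set such as an equilateral
  triangle need not fit into a disc of half its diameter. Comparing the kernels two at a time
  therefore does not bound the norm without loss. Testing against all zero-sum coefficients does:
  the positive and negative parts of such coefficients have equal mass and can be matched by a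
  transport plan, which brings back pairs of translates with the sharp constant. The value arises
  from \<open>r = (a - b) / (a + b)\<close>, for which \<open>2 * r / (1 - r^2)\<close> equals
  \<open>(a / b - b / a) / 2\<close>. The other obstacle is that perimeter and boundary curve are
  arbitrary choices among the objects satisfying \<open>arclength_param\<close>, a predicate that
  demands neither continuity nor smoothness. Hence every such parametrization has to be identified
  as \<open>ellipse_point\<close> after a phase with derivative 1/speed. This makes the tangents
  computable, and substituting the phase turns arclength into the angle.\<close>

section \<open>Integrals of periodic functions and the addition law for arctan\<close>

lemma antiderivative_on_line:
  fixes f :: "real \<Rightarrow> 'a::euclidean_space"
  assumes "continuous_on UNIV f"
  obtains F where "\<And>x. (F has_vector_derivative f x) (at x)"
proof -
  have "\<And>x. isCont f x"
    using assms by (simp add: continuous_on_eq_continuous_at)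
  then show ?thesis
    using einterval_antiderivative[of "-\<infinity>" "\<infinity>" f] that by auto
qed

lemma has_vector_derivative_shift:
  assumes "(F has_vector_derivative D) (at (x + d))"
  shows "((\<lambda>t. F (t + d)) has_vector_derivative D) (at (x::real))"
proof -
  have "((\<lambda>t. t + d) has_vector_derivative 1) (at x)"
    by (auto intro!: derivative_eq_intros)
  from vector_diff_chain_at[OF this assms] show ?thesis
    by (simp add: o_def)
qed

text \<open>With an antiderivative \<open>F\<close> on the whole line, all three integrals are
  increments of \<open>F\<close> over a length \<open>p\<close>, and periodicity makes
  \<open>F (x + p) - F x\<close> constant. No interval has to be cut at multiples of
  \<open>p\<close>.\<close>

lemma integral_periodic_shift:
  fixes f :: "real \<Rightarrow> 'a::euclidean_space"
  assumes cont: "continuous_on UNIV f" and per: "\<And>x. f (x + p) = f x" and "0 \<le> p"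
  shows "integral {0..p} (\<lambda>t. f (t + c)) = integral {0..p} f"
    and "integral {c..c + p} f = integral {0..p} f"
proof -
  obtain F where F: "\<And>x. (F has_vector_derivative f x) (at x)"
    using antiderivative_on_line[OF cont] by blast
  note shift = has_vector_derivative_shift[OF F]
  have "((\<lambda>x. F (x + p) - F x) has_vector_derivative f (x + p) - f x) (at x)" for x
    by (intro has_vector_derivative_diff shift F)
  then have "((\<lambda>x. F (x + p) - F x) has_vector_derivative 0) (at x within UNIV)" for x
    by (simp add: per)
  then obtain k where k: "\<And>x. F (x + p) - F x = k"
    using has_vector_derivative_zero_constant[of UNIV] by auto
  have const: "F (x + p) - F x = F p - F 0" for x
    using k[of x] k[of 0] by simp
  have "((\<lambda>t. f (t + c)) has_integral (F (p + c) - F (0 + c))) {0..p}"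
    by (rule fundamental_theorem_of_calculus[OF \<open>0 \<le> p\<close>])
       (rule has_vector_derivative_at_within[OF shift])
  moreover have "(f has_integral (F p - F 0)) {0..p}"
    by (rule fundamental_theorem_of_calculus[OF \<open>0 \<le> p\<close>])
       (rule has_vector_derivative_at_within[OF F])
  moreover have "(f has_integral (F (c + p) - F c)) {c..c + p}"
    by (rule fundamental_theorem_of_calculus)
       (use \<open>0 \<le> p\<close> in \<open>simp_all add: has_vector_derivative_at_within F\<close>)
  ultimately show "integral {0..p} (\<lambda>t. f (t + c)) = integral {0..p} f"
    "integral {c..c + p} f = integral {0..p} f"
    using const[of c] by (auto simp: add.commute dest!: integral_unique)
qed

text \<open>For \<open>x > 0\<close> the hypothesis says \<open>y < 1 / x\<close>, and
  \<open>arctan (1 / x)\<close> is complementary to \<open>arctan x\<close>; the case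
  \<open>x < 0\<close> is symmetric. So the sum of the two angles stays in the principal branch,
  where the addition formula for \<open>tan\<close> determines it.\<close>

lemma arctan_add_general:
  fixes x y :: real
  assumes "x * y < 1"
  shows "arctan x + arctan y = arctan ((x + y) / (1 - x * y))"
proof -
  have "\<bar>arctan x + arctan y\<bar> < pi / 2"
  proof (cases "x = 0")
    case True
    then show ?thesis using arctan_bounded[of y] by auto
  next
    case False
    have inv: "arctan (1 / x) = sgn x * pi / 2 - arctan x"
      using Transcendental.arctan_inverse[OF False] by (simp add: inverse_eq_divide)
    show ?thesis
    proof (cases "0 < x")
      case True
      then have "y < 1 / x" using assms by (simp add: field_simps)
      then have "arctan y < arctan (1 / x)" by (simp add: arctan_less_iff)
      moreover have "0 < arctan x" using True by (simp add: zero_less_arctan_iff)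
      moreover have "arctan (1 / x) = pi / 2 - arctan x" using inv True by simp
      ultimately show ?thesis using arctan_lbound[of y] by linarith
    next
      case F: False
      with False have x: "x < 0" by simp
      then have "1 / x < y" using assms by (simp add: field_simps)
      then have "arctan (1 / x) < arctan y" by (simp add: arctan_less_iff)
      moreover have "arctan x < 0" using x by (simp add: arctan_less_zero_iff)
      moreover have "arctan (1 / x) = - pi / 2 - arctan x" using inv x by simp
      ultimately show ?thesis using arctan_ubound[of y] by linarith
    qed
  qed
  then have b: "- (pi / 2) < arctan x + arctan y" "arctan x + arctan y < pi / 2"
    by linarith+
  then have "cos (arctan x + arctan y) \<noteq> 0"
    using cos_gt_zero_pi[of "arctan x + arctan y"] by simp
  then have "tan (arctan x + arctan y) = (x + y) / (1 - x * y)"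
    by (subst tan_add) (auto simp: tan_arctan cos_arctan_not_zero)
  from arctan_unique[OF b this] show ?thesis by simp
qed

section \<open>The Poisson kernel\<close>

text \<open>Poisson kernel of the unit disc at the real point \<open>r\<close>, normalized to mass 1
  over a period. Negative \<open>r\<close> occurs below when \<open>a < b\<close>.\<close>

definition poisson :: "real \<Rightarrow> real \<Rightarrow> real" where
  "poisson r x = (1 - r\<^sup>2) / (2 * pi * (1 - 2 * r * cos x + r\<^sup>2))"

context
  fixes r :: real
  assumes r: "\<bar>r\<bar> < 1"
begin

lemma square_less_one: "r\<^sup>2 < 1"
  using r by (simp add: abs_square_less_1)

lemma mult_cos_less_one: "r * cos x < 1"
proof -
  have "\<bar>r * cos x\<bar> \<le> \<bar>r\<bar> * 1"
    unfolding abs_mult by (intro mult_left_mono) auto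
  with r show ?thesis by linarith
qed

text \<open>Both sides are the squared modulus of 1 - r e^{ix}.\<close>

lemma poisson_denominator: "1 - 2 * r * cos x + r\<^sup>2 = (1 - r * cos x)\<^sup>2 + (r * sin x)\<^sup>2"
  using sin_cos_squared_add[of x] by algebra

lemma poisson_denominator_pos: "0 < 1 - 2 * r * cos x + r\<^sup>2"
  using mult_cos_less_one[of x] unfolding poisson_denominator by (simp add: add_pos_nonneg)

lemma poisson_pos: "0 < poisson r x"
  using square_less_one poisson_denominator_pos[of x] by (simp add: poisson_def)

lemma continuous_on_poisson [continuous_intros]:
  "continuous_on S g \<Longrightarrow> continuous_on S (\<lambda>x. poisson r (g x))"
proof -
  have "isCont (poisson r) x" for x
    unfolding poisson_def[abs_def] using poisson_denominator_pos[of x]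
    by (intro continuous_intros) auto
  then have "continuous_on UNIV (poisson r)"
    by (simp add: continuous_at_imp_continuous_on)
  then show "continuous_on S g \<Longrightarrow> continuous_on S (\<lambda>x. poisson r (g x))"
    by (rule continuous_on_compose2) auto
qed

lemma poisson_periodic: "poisson r (x + 2 * pi) = poisson r x"
  by (simp add: poisson_def)

text \<open>Minus the argument of 1 - r e^{ix}. The real part of that number is positive, so
  \<open>arctan\<close> gives a smooth periodic branch on the whole line.\<close>

definition poisson_phase :: "real \<Rightarrow> real" where
  "poisson_phase x = arctan (r * sin x / (1 - r * cos x))"

definition poisson_primitive :: "real \<Rightarrow> real" where
  "poisson_primitive x = x / (2 * pi) + poisson_phase x / pi"

text \<open>The derivative of the phase is the real part of r e^{ix} / (1 - r e^{ix}), that is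
  \<open>(r * cos x - r^2)\<close> over the denominator; the kernel is the constant
  \<open>1 / (2 * pi)\<close> plus \<open>1 / pi\<close> times this.\<close>

lemma poisson_primitive_deriv:
  "(poisson_primitive has_vector_derivative poisson r x) (at x)"
proof -
  have nz: "1 - r * cos x \<noteq> 0" using mult_cos_less_one[of x] by linarith
  have D: "1 - 2 * r * cos x + r\<^sup>2 \<noteq> 0" using poisson_denominator_pos[of x] by linarith
  let ?D = "1 - 2 * r * cos x + r\<^sup>2"
  let ?q = "(r * cos x * (1 - r * cos x) - r * sin x * (r * sin x)) / (1 - r * cos x)\<^sup>2"
  have e: "?q = (r * cos x - r\<^sup>2) / (1 - r * cos x)\<^sup>2"
    using sin_cos_squared_add[of x] by (intro arg_cong2[of _ _ _ _ "(/)"] refl) algebra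
  have f: "1 + (r * sin x / (1 - r * cos x))\<^sup>2 = ?D / (1 - r * cos x)\<^sup>2"
    using nz unfolding poisson_denominator by (simp add: power_divide field_simps)
  have "((\<lambda>x. r * sin x / (1 - r * cos x)) has_real_derivative ?q) (at x)"
    using nz by (auto intro!: derivative_eq_intros simp: power2_eq_square)
  then have "(poisson_phase has_real_derivative inverse (1 + (r * sin x / (1 - r * cos x))\<^sup>2) * ?q) (at x)"
    unfolding poisson_phase_def[abs_def]
    by (rule DERIV_chain2[of arctan, OF DERIV_arctan])
  also have "inverse (1 + (r * sin x / (1 - r * cos x))\<^sup>2) * ?q = (r * cos x - r\<^sup>2) / ?D"
    unfolding f e using nz by simp
  finally have "(poisson_primitive has_real_derivative 1 / (2 * pi) + (r * cos x - r\<^sup>2) / ?D / pi) (at x)"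
    unfolding poisson_primitive_def[abs_def]
    by (auto intro!: derivative_eq_intros)
  also have "1 / (2 * pi) + (r * cos x - r\<^sup>2) / ?D / pi = poisson r x"
  proof -
    have "(1 / 2 + (r * cos x - r\<^sup>2) / ?D) / pi = ((1 - r\<^sup>2) / (2 * ?D)) / pi"
      using D by (simp add: divide_simps)
    then show ?thesis by (simp add: poisson_def add_divide_distrib mult_ac)
  qed
  finally show ?thesis by (simp add: has_real_derivative_iff_has_vector_derivative)
qed

text \<open>The phase is periodic, so only the linear part of the primitive contributes.\<close>

lemma poisson_integral:
  "((\<lambda>t. poisson r (t + u)) has_integral 1) {0..2 * pi}"
proof -
  have "((\<lambda>t. poisson r (t + u)) has_integral
      poisson_primitive (2 * pi + u) - poisson_primitive (0 + u)) {0..2 * pi}"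
    by (rule fundamental_theorem_of_calculus)
       (simp_all add: has_vector_derivative_at_within has_vector_derivative_shift poisson_primitive_deriv)
  also have "poisson_primitive (2 * pi + u) - poisson_primitive (0 + u) = 1"
    using sin_periodic[of u] cos_periodic[of u]
    by (simp add: poisson_primitive_def poisson_phase_def add.commute[of u] add_divide_distrib)
  finally show ?thesis .
qed

text \<open>The tangents of the two phases are \<open>r * sin d\<close> over
  \<open>1 - r * cos d\<close> and over \<open>1 + r * cos d\<close>, and (1 - r cos d)(1 + r cos d)
  - (r sin d)^2 = 1 - r^2. This sum is what the primitive of a difference of translates leaves at
  its sign changes.\<close>

lemma poisson_phase_add:
  "poisson_phase d + poisson_phase (pi - d) = arctan (2 * r * sin d / (1 - r\<^sup>2))"
proof -
  let ?u = "1 - r * cos d" and ?v = "1 + r * cos d" and ?s = "r * sin d"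
  have p: "0 < ?u" "0 < ?v"
    using mult_cos_less_one[of d] mult_cos_less_one[of "d + pi"] by auto
  have q: "?u * ?v - ?s * ?s = 1 - r\<^sup>2"
    using sin_cos_squared_add[of d] by algebra
  have one: "1 - ?s / ?u * (?s / ?v) = (1 - r\<^sup>2) / (?u * ?v)"
    unfolding q[symmetric] using p by (simp add: diff_divide_distrib)
  moreover have "0 < (1 - r\<^sup>2) / (?u * ?v)"
    using p square_less_one by simp
  ultimately have xy: "?s / ?u * (?s / ?v) < 1"
    by linarith
  note one
  moreover have "?s / ?u + ?s / ?v = 2 * ?s / (?u * ?v)"
    using p by (simp add: field_simps)
  ultimately have "(?s / ?u + ?s / ?v) / (1 - ?s / ?u * (?s / ?v)) = 2 * ?s / (1 - r\<^sup>2)"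
    using p by simp
  moreover have "poisson_phase d + poisson_phase (pi - d) = arctan (?s / ?u) + arctan (?s / ?v)"
    by (simp add: poisson_phase_def)
  ultimately show ?thesis
    unfolding arctan_add_general[OF xy] by (simp only: mult.assoc)
qed

text \<open>Recentred at the midpoint of the shifts, the difference \<open>g\<close> is a positive
  function times \<open>- sin x * (r * sin d)\<close>. Its sign can change only at multiples of pi,
  so the integral of its modulus reduces to values of the primitive \<open>G\<close> at 0, pi and
  \<open>2 * pi\<close>.\<close>

lemma poisson_L1_distance:
  "integral {0..2 * pi} (\<lambda>t. \<bar>poisson r (t + u) - poisson r (t + v)\<bar>)
    = 4 / pi * \<bar>arctan (2 * r * sin ((u - v) / 2) / (1 - r\<^sup>2))\<bar>"
proof -
  define d where "d = (u - v) / 2"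
  define m where "m = (u + v) / 2"
  define g where "g x = poisson r (x + d) - poisson r (x - d)" for x
  define G where "G x = poisson_primitive (x + d) - poisson_primitive (x - d)" for x
  define h where "h = 2 / pi * arctan (2 * r * sin d / (1 - r\<^sup>2))"
  have md: "t + m + d = t + u" "t + m - d = t + v" for t
    by (simp_all add: m_def d_def field_simps)
  have contg: "continuous_on S g" for S
    unfolding g_def[abs_def] by (intro continuous_intros)
  have perg: "g (x + 2 * pi) = g x" for x
    using poisson_periodic[of "x + d"] poisson_periodic[of "x - d"]
    by (simp add: g_def algebra_simps)
  have "integral {0..2 * pi} (\<lambda>t. \<bar>poisson r (t + u) - poisson r (t + v)\<bar>)
      = integral {0..2 * pi} (\<lambda>t. \<bar>g (t + m)\<bar>)"
    by (simp add: g_def md)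
  also have "\<dots> = integral {0..2 * pi} (\<lambda>t. \<bar>g t\<bar>)"
    by (rule integral_periodic_shift(1)[of "\<lambda>t. \<bar>g t\<bar>"])
       (auto intro!: continuous_on_rabs contg simp: perg)
  also have "\<dots> = 2 * \<bar>h\<bar>"
  proof -
    have deriv: "(G has_vector_derivative g x) (at x within S)" for x S
      unfolding G_def[abs_def] g_def
      using has_vector_derivative_shift[OF poisson_primitive_deriv, of d x]
        has_vector_derivative_shift[OF poisson_primitive_deriv, of "- d" x]
      by (intro has_vector_derivative_at_within[OF has_vector_derivative_diff]) simp_all
    have g_eq: "\<exists>c>0. g x = - c * sin x * (r * sin d)" for x
    proof -
      define D where "D x = 1 - 2 * r * cos x + r\<^sup>2" for x
      have pos: "0 < D (x + d)" "0 < D (x - d)"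
        unfolding D_def by (rule poisson_denominator_pos)+
      have diff: "D (x - d) - D (x + d) = - 4 * sin x * (r * sin d)"
        by (simp add: D_def cos_add cos_diff algebra_simps)
      have "g x = (1 - r\<^sup>2) / (2 * pi) * (1 / D (x + d) - 1 / D (x - d))"
        by (simp add: g_def poisson_def D_def[symmetric] right_diff_distrib)
      also have "\<dots> = (1 - r\<^sup>2) / (2 * pi) * ((D (x - d) - D (x + d)) / (D (x + d) * D (x - d)))"
        using pos by (simp add: diff_frac_eq)
      also have "\<dots> = - (2 * (1 - r\<^sup>2) / (pi * (D (x + d) * D (x - d)))) * sin x * (r * sin d)"
        unfolding diff by simp
      finally have "g x = - (2 * (1 - r\<^sup>2) / (pi * (D (x + d) * D (x - d)))) * sin x * (r * sin d)" .
      moreover have "0 < 2 * (1 - r\<^sup>2) / (pi * (D (x + d) * D (x - d)))"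
        using pos square_less_one by simp
      ultimately show ?thesis by blast
    qed
    have abs_g: "\<bar>g x\<bar> = - sgn (r * sin d) * sgn (sin x) * g x" for x
    proof -
      obtain c where c: "0 < c" "g x = - c * sin x * (r * sin d)"
        using g_eq by blast
      have "\<bar>g x\<bar> = c * (\<bar>sin x\<bar> * \<bar>r * sin d\<bar>)"
        using c by (simp add: abs_mult)
      also have "\<dots> = - sgn (r * sin d) * sgn (sin x) * g x"
        using c by (simp add: abs_sgn[of "sin x"] abs_sgn[of "r * sin d"] mult_ac)
      finally show ?thesis .
    qed
    \<comment> \<open>In \<open>G pi - G 0\<close> the linear parts cancel. The phase is odd about 0
      and about pi, so the four phase values combine into twice the sum in
      \<open>poisson_phase_add\<close>.\<close>
    have "poisson_phase (- d) = - poisson_phase d" "poisson_phase (pi + d) = - poisson_phase (pi - d)"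
      by (simp_all add: poisson_phase_def arctan_minus)
    then have "G pi - G 0 = - (2 / pi * (poisson_phase d + poisson_phase (pi - d)))"
      by (simp add: G_def poisson_primitive_def add_divide_distrib diff_divide_distrib ring_distribs)
    then have G_pi: "G pi - G 0 = - h"
      unfolding poisson_phase_add h_def .
    have G_2pi: "G (2 * pi) = G 0"
      using sin_periodic[of d] cos_periodic[of d] sin_periodic[of "-d"] cos_periodic[of "-d"]
      by (simp add: G_def poisson_primitive_def poisson_phase_def add.commute[of _ "2 * pi"] field_simps)
    \<comment> \<open>A constant sign is asked for on the open interval only, because
      \<open>sin\<close> vanishes at the ends used below; the two ends do not affect the
      integral.\<close>
    have half: "((\<lambda>x. \<bar>g x\<bar>) has_integral \<epsilon> * (G q - G p)) {p..q}"
      if "p \<le> q" and e: "\<And>x. x \<in> {p<..<q} \<Longrightarrow> - sgn (r * sin d) * sgn (sin x) = \<epsilon>" for p q \<epsilon>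
    proof -
      have int: "((\<lambda>x. \<epsilon> * g x) has_integral \<epsilon> * (G q - G p)) {p..q}"
        by (intro has_integral_mult_right fundamental_theorem_of_calculus deriv that)
      have eq: "\<bar>g x\<bar> = \<epsilon> * g x" if "x \<in> {p..q} - {p, q}" for x
      proof -
        have "x \<in> {p<..<q}" using that by auto
        from e[OF this] show ?thesis unfolding abs_g by (simp only:)
      qed
      show ?thesis
        by (rule has_integral_spike_finite[of "{p, q}", OF _ eq int]) auto
    qed
    have "((\<lambda>x. \<bar>g x\<bar>) has_integral - sgn (r * sin d) * (G pi - G 0)) {0..pi}"
      by (rule half) (auto simp: sin_gt_zero)
    moreover have "((\<lambda>x. \<bar>g x\<bar>) has_integral sgn (r * sin d) * (G (2 * pi) - G pi)) {pi..2 * pi}"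
      by (rule half) (auto simp: sin_lt_zero)
    ultimately have "((\<lambda>x. \<bar>g x\<bar>) has_integral
        - sgn (r * sin d) * (G pi - G 0) + sgn (r * sin d) * (G (2 * pi) - G pi)) {0..2 * pi}"
      by (intro has_integral_combine[of 0 pi "2 * pi"]) auto
    also have "- sgn (r * sin d) * (G pi - G 0) + sgn (r * sin d) * (G (2 * pi) - G pi)
        = 2 * (sgn (r * sin d) * h)"
    proof -
      have "- sgn (r * sin d) * (G pi - G 0) + sgn (r * sin d) * (G (2 * pi) - G pi)
          = - 2 * (sgn (r * sin d) * (G pi - G 0))"
        unfolding G_2pi by (simp only: ring_distribs)
      then show ?thesis unfolding G_pi by simp
    qed
    also have "sgn (r * sin d) * h = \<bar>h\<bar>"
    proof -
      have "sgn h = sgn (r * sin d)"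
        using square_less_one
        by (auto simp: h_def sgn_if zero_less_arctan_iff zero_less_divide_iff zero_less_mult_iff)
      then show ?thesis by (metis abs_sgn mult.commute)
    qed
    finally show ?thesis by (rule integral_unique)
  qed
  finally show ?thesis
    by (simp add: h_def d_def abs_mult)
qed

text \<open>Half of the distance in \<open>poisson_L1_distance\<close> where the sine has modulus 1,
  its largest value; the half turns a diameter into a radius.\<close>

definition poisson_bound :: real where
  "poisson_bound = 2 / pi * arctan (2 * \<bar>r\<bar> / (1 - r\<^sup>2))"

lemma poisson_L1_distance_le:
  "integral {0..2 * pi} (\<lambda>t. \<bar>poisson r (t + u) - poisson r (t + v)\<bar>) \<le> 2 * poisson_bound"
proof -
  define x where "x = 2 * r * sin ((u - v) / 2) / (1 - r\<^sup>2)"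
  define y where "y = 2 * \<bar>r\<bar> / (1 - r\<^sup>2)"
  have "\<bar>x\<bar> \<le> y"
    using square_less_one mult_left_mono[OF abs_sin_le_one[of "(u - v) / 2"], of "\<bar>r\<bar>"]
    by (simp add: x_def y_def abs_mult divide_right_mono)
  then have "arctan x \<le> arctan y" "arctan (- y) \<le> arctan x"
    by (simp_all only: arctan_le_iff abs_le_iff) linarith+
  then have "\<bar>arctan x\<bar> \<le> arctan y"
    unfolding arctan_minus by linarith
  then show ?thesis
    unfolding poisson_L1_distance poisson_bound_def x_def[symmetric] y_def[symmetric]
    by (simp add: divide_right_mono)
qed

lemma poisson_L1_distance_antipodal:
  "integral {0..2 * pi} (\<lambda>t. \<bar>poisson r (t + pi) - poisson r t\<bar>) = 2 * poisson_bound"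
proof -
  have "\<bar>arctan (2 * r / (1 - r\<^sup>2))\<bar> = arctan (2 * \<bar>r\<bar> / (1 - r\<^sup>2))"
    using square_less_one by (simp add: abs_if arctan_minus divide_less_0_iff)
  then show ?thesis
    using poisson_L1_distance[of pi 0] by (simp add: poisson_bound_def)
qed

end

section \<open>Smallest enclosing discs and zero-sum combinations\<close>

text \<open>Maximizing \<open>q - \<bar>p\<bar>\<^sup>2\<close> over the convex hull of the points \<open>(w, \<bar>w\<bar>\<^sup>2)\<close> gives the centre \<open>p\<close> of the
  smallest enclosing disc, together with the convex combination that certifies its radius.\<close>

lemma enclosing_disc_certificate:
  fixes W :: "complex set"
  assumes "compact W" "W \<noteq> {}"
  obtains p R S u where "\<And>w. w \<in> W \<Longrightarrow> (cmod (w - p))\<^sup>2 \<le> R"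
    "finite S" "S \<subseteq> W" "\<And>w. w \<in> S \<Longrightarrow> 0 \<le> u w" "sum u S = (1::real)"
    "(\<Sum>w\<in>S. u w *\<^sub>R w) = p" "(\<Sum>w\<in>S. u w * (cmod (w - p))\<^sup>2) = R"
proof -
  define lift where "lift w = (w, (cmod w)\<^sup>2)" for w
  define H where "H = convex hull (lift ` W)"
  have "compact (lift ` W)"
    unfolding lift_def using assms(1) by (intro compact_continuous_image continuous_intros)
  then have "compact H" "H \<noteq> {}"
    using assms(2) by (auto simp: H_def compact_convex_hull)
  moreover have "continuous_on H (\<lambda>x. snd x - (cmod (fst x))\<^sup>2)"
    by (intro continuous_intros)
  ultimately obtain x where x: "x \<in> H"
    and max: "\<And>y. y \<in> H \<Longrightarrow> snd y - (cmod (fst y))\<^sup>2 \<le> snd x - (cmod (fst x))\<^sup>2"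
    using continuous_attains_sup[of H "\<lambda>x. snd x - (cmod (fst x))\<^sup>2"] by blast
  obtain p q where pq: "x = (p, q)" by (cases x)
  have sq: "(cmod (z - p))\<^sup>2 = (cmod z)\<^sup>2 - 2 * inner p z + (cmod p)\<^sup>2" for z
    by (simp add: power2_norm_eq_inner inner_diff inner_commute)
  show ?thesis
  proof -
    obtain T v where T: "finite T" "T \<subseteq> lift ` W" "\<And>y. y \<in> T \<Longrightarrow> 0 \<le> v y" "sum v T = 1"
      "(\<Sum>y\<in>T. v y *\<^sub>R y) = x"
      using x unfolding H_def convex_hull_explicit by blast
    obtain S where S: "finite S" "S \<subseteq> W" "T = lift ` S"
      using finite_subset_image[OF T(1,2)] by auto
    have inj: "inj_on lift S"
      by (auto simp: lift_def inj_on_def)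
    define u where "u w = v (lift w)" for w
    have sum1: "sum u S = 1"
      using T(4) by (simp add: S(3) sum.reindex[OF inj] u_def o_def)
    have "(\<Sum>w\<in>S. u w *\<^sub>R lift w) = (p, q)"
      using T(5) by (simp add: S(3) sum.reindex[OF inj] u_def o_def pq)
    then have sums: "(\<Sum>w\<in>S. u w *\<^sub>R w) = p" "(\<Sum>w\<in>S. u w * (cmod w)\<^sup>2) = q"
      by (auto simp: prod_eq_iff fst_sum snd_sum lift_def)
    \<comment> \<open>A variance identity: the maximal value of the objective is the mean squared
      distance from the barycentre \<open>p\<close> under the weights \<open>u\<close>.\<close>
    have "(\<Sum>w\<in>S. u w * (cmod (w - p))\<^sup>2)
        = (\<Sum>w\<in>S. u w * (cmod w)\<^sup>2) - 2 * inner p (\<Sum>w\<in>S. u w *\<^sub>R w) + (cmod p)\<^sup>2 * sum u S"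
      unfolding sq inner_sum_right sum_distrib_left sum.distrib[symmetric] sum_subtractf[symmetric]
      by (intro sum.cong refl) (simp add: algebra_simps)
    also have "\<dots> = q - (cmod p)\<^sup>2"
      by (simp add: sums sum1 flip: power2_norm_eq_inner)
    finally have R: "(\<Sum>w\<in>S. u w * (cmod (w - p))\<^sup>2) = q - (cmod p)\<^sup>2" .
    have enc: "(cmod (w - p))\<^sup>2 \<le> q - (cmod p)\<^sup>2" if "w \<in> W" for w
    proof -
      define A where "A = (cmod (w - p))\<^sup>2"
      \<comment> \<open>First-order optimality. Moving from \<open>x\<close> towards
        \<open>lift w\<close> by the fraction \<open>\<tau>\<close> changes the objective by
        \<open>\<tau>\<close> times the left side minus \<open>\<tau>\<close> squared times
        \<open>A\<close>, which cannot be positive; then \<open>\<tau>\<close> tends to 0.\<close>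
      have bound: "A - (q - (cmod p)\<^sup>2) \<le> \<tau> * A" if \<tau>: "0 < \<tau>" "\<tau> \<le> 1" for \<tau>
      proof -
        have "lift w \<in> H"
          using \<open>w \<in> W\<close> by (simp add: H_def hull_inc)
        then have "(1 - \<tau>) *\<^sub>R x + \<tau> *\<^sub>R lift w \<in> H"
          using \<tau> x convex_convex_hull[of "lift ` W"] by (intro convexD) (auto simp: H_def)
        from max[OF this] have
          "(1 - \<tau>) * q + \<tau> * (cmod w)\<^sup>2 - (cmod ((1 - \<tau>) *\<^sub>R p + \<tau> *\<^sub>R w))\<^sup>2 \<le> q - (cmod p)\<^sup>2"
          by (simp add: pq lift_def)
        moreover have "(cmod ((1 - \<tau>) *\<^sub>R p + \<tau> *\<^sub>R w))\<^sup>2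
            = (cmod p)\<^sup>2 + 2 * \<tau> * (inner p w - (cmod p)\<^sup>2) + \<tau>\<^sup>2 * A"
          unfolding A_def power2_norm_eq_inner
          by (simp only: inner_add inner_diff inner_scaleR_left inner_scaleR_right inner_commute[of w p])
             algebra
        ultimately have "\<tau> * (A - (q - (cmod p)\<^sup>2)) \<le> \<tau> * (\<tau> * A)"
          unfolding A_def sq by (simp add: algebra_simps power2_eq_square)
        then show ?thesis using \<tau> by simp
      qed
      have "A - (q - (cmod p)\<^sup>2) \<le> 0"
      proof (rule tendsto_lowerbound)
        show "((\<lambda>\<tau>. \<tau> * A) \<longlongrightarrow> 0) (at_right 0)"
          by (auto intro!: tendsto_eq_intros)
        show "\<forall>\<^sub>F \<tau> in at_right 0. A - (q - (cmod p)\<^sup>2) \<le> \<tau> * A"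
          using bound by (auto simp: eventually_at_right_field intro!: exI[of _ 1])
      qed simp
      then show ?thesis by (simp add: A_def)
    qed
    show ?thesis
      by (rule that[OF enc S(1,2) _ sum1 sums(1) R]) (use T(3) S(3) in \<open>auto simp: u_def\<close>)
  qed
qed

text \<open>A duality statement: the hypothesis ranges over all zero-sum combinations, not only
  differences of two points, since a planar set of diameter \<open>2 * C\<close> need not fit into a
  disc of radius \<open>C\<close>. It is applied to one combination, built from the certificate of
  the smallest disc.\<close>

lemma common_centre:
  fixes W :: "complex set"
  assumes W: "compact W" and "0 \<le> C"
    and bound: "\<And>S c. finite S \<Longrightarrow> S \<subseteq> W \<Longrightarrow> sum c S = 0 \<Longrightarrow>
      cmod (\<Sum>w\<in>S. c w * w) \<le> C * (\<Sum>w\<in>S. cmod (c w))"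
  obtains z where "\<And>w. w \<in> W \<Longrightarrow> cmod (w - z) \<le> C"
proof (cases "W = {}")
  case False
  obtain p R S u where enc: "\<And>w. w \<in> W \<Longrightarrow> (cmod (w - p))\<^sup>2 \<le> R"
    and S: "finite S" "S \<subseteq> W" and u: "\<And>w. w \<in> S \<Longrightarrow> 0 \<le> u w" "sum u S = (1::real)"
    and p: "(\<Sum>w\<in>S. u w *\<^sub>R w) = p" and R: "(\<Sum>w\<in>S. u w * (cmod (w - p))\<^sup>2) = R"
    by (rule enclosing_disc_certificate[OF W False]) blast
  have R0: "0 \<le> R"
    unfolding R[symmetric] using u by (intro sum_nonneg) auto
  \<comment> \<open>These coefficients sum to 0 because \<open>p\<close> is the barycentre. Thus
    \<open>w\<close> may be replaced by \<open>w - p\<close> in the combination, which then equals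
    \<open>R\<close>, while the moduli sum to at most \<open>sqrt R\<close>; hence R <= C sqrt
    R.\<close>
  define c where "c w = of_real (u w) * cnj (w - p)" for w
  have "(\<Sum>w\<in>S. u w *\<^sub>R (w - p)) = 0"
    by (simp add: scaleR_diff_right sum_subtractf p scaleR_sum_left[symmetric] u)
  then have "cnj (\<Sum>w\<in>S. u w *\<^sub>R (w - p)) = 0"
    by (simp only: complex_cnj_zero)
  then have c0: "sum c S = 0"
    by (simp add: c_def cnj_sum scaleR_conv_of_real)
  have "(\<Sum>w\<in>S. c w * w) = (\<Sum>w\<in>S. c w * (w - p))"
    using c0 by (simp add: right_diff_distrib sum_subtractf sum_distrib_right[symmetric])
  also have "\<dots> = of_real R"
    unfolding R[symmetric] of_real_sum
    by (intro sum.cong refl) (simp only: c_def of_real_mult complex_norm_square mult_ac)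
  finally have "R \<le> C * (\<Sum>w\<in>S. cmod (c w))"
    using bound[OF S c0] R0 by simp
  also have "(\<Sum>w\<in>S. cmod (c w)) \<le> (\<Sum>w\<in>S. u w * sqrt R)"
  proof (rule sum_mono)
    fix w assume w: "w \<in> S"
    then have "cmod (w - p) \<le> sqrt R"
      using enc S by (intro real_le_rsqrt) auto
    then show "cmod (c w) \<le> u w * sqrt R"
      using u(1)[OF w] by (auto simp: c_def norm_mult complex_mod_cnj simp del: complex_cnj_diff intro!: mult_left_mono)
  qed
  also have "(\<Sum>w\<in>S. u w * sqrt R) = sqrt R"
    by (simp add: sum_distrib_right[symmetric] u)
  finally have le: "sqrt R * sqrt R \<le> C * sqrt R"
    using \<open>0 \<le> C\<close> R0 by (simp add: mult_left_mono)
  have "sqrt R \<le> C"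
    using le R0 \<open>0 \<le> C\<close> mult_right_le_imp_le[of "sqrt R" "sqrt R" C] by (cases "R = 0") auto
  show ?thesis
  proof (rule that)
    fix w assume "w \<in> W"
    then have "cmod (w - p) \<le> sqrt R"
      using enc by (intro real_le_rsqrt) auto
    with \<open>sqrt R \<le> C\<close> show "cmod (w - p) \<le> C" by linarith
  qed
qed auto

section \<open>L1 norms of zero-sum combinations\<close>

text \<open>The integrand is \<open>cmod z\<close> times the modulus of
  \<open>cos (\<theta> + Arg z)\<close>, and periodicity removes the shift by
  \<open>Arg z\<close>.\<close>

lemma integral_abs_Re_cis:
  "integral {0..2 * pi} (\<lambda>\<theta>. \<bar>Re (cis \<theta> * z)\<bar>) = cmod z * integral {0..2 * pi} (\<lambda>\<theta>. \<bar>cos \<theta>\<bar>)"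
proof -
  have Re: "Re (cis \<theta> * z) = cmod z * cos (\<theta> + Arg z)" for \<theta>
  proof -
    have "Re (cis \<theta> * rcis (cmod z) (Arg z)) = cmod z * cos (\<theta> + Arg z)"
      by (simp add: rcis_def cos_add algebra_simps)
    then show ?thesis by (simp only: rcis_cmod_Arg)
  qed
  have "integral {0..2 * pi} (\<lambda>\<theta>. \<bar>Re (cis \<theta> * z)\<bar>)
      = cmod z * integral {0..2 * pi} (\<lambda>\<theta>. \<bar>cos (\<theta> + Arg z)\<bar>)"
    by (simp only: Re abs_mult abs_norm_cancel integral_mult_right)
  also have "integral {0..2 * pi} (\<lambda>\<theta>. \<bar>cos (\<theta> + Arg z)\<bar>) = integral {0..2 * pi} (\<lambda>\<theta>. \<bar>cos \<theta>\<bar>)"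
    by (rule integral_periodic_shift(1)[of "\<lambda>\<theta>. \<bar>cos \<theta>\<bar>"]) (auto intro!: continuous_intros)
  finally show ?thesis .
qed

lemma integral_abs_cos_pos: "0 < integral {0..2 * pi} (\<lambda>\<theta>. \<bar>cos \<theta>\<bar>)"
proof -
  have cont: "continuous_on S (\<lambda>\<theta>. \<bar>cos \<theta>\<bar>)" for S :: "real set"
    by (intro continuous_intros)
  have "((\<lambda>\<theta>. cos \<theta>) has_integral (sin (pi / 2) - sin 0)) {0..pi / 2}"
    by (rule fundamental_theorem_of_calculus)
       (auto intro!: derivative_eq_intros simp flip: has_real_derivative_iff_has_vector_derivative)
  then have "1 = integral {0..pi / 2} (\<lambda>\<theta>. cos \<theta>)"
    by (simp add: integral_unique)
  also have "\<dots> \<le> integral {0..pi / 2} (\<lambda>\<theta>. \<bar>cos \<theta>\<bar>)"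
    by (intro integral_le integrable_continuous_interval cont continuous_intros) auto
  also have "\<dots> \<le> integral {0..2 * pi} (\<lambda>\<theta>. \<bar>cos \<theta>\<bar>)"
    by (intro integral_subset_le integrable_continuous_interval cont) auto
  finally show ?thesis by linarith
qed

text \<open>The positive part \<open>P\<close> and negative part \<open>N\<close> of the
  coefficients have the same mass \<open>s\<close>. The product plan \<open>P i * N j\<close> writes
  \<open>s\<close> times the combination as a double sum of differences
  \<open>k i t - k j t\<close>. Its total weight is s^2, each difference costs at most
  \<open>2 * C\<close>, and the moduli of the coefficients sum to \<open>2 * s\<close>.\<close>

lemma zero_sum_L1_bound_real:
  fixes k :: "'i \<Rightarrow> real \<Rightarrow> real"
  assumes "finite S" and c0: "sum c S = 0"
    and cont: "\<And>i. i \<in> S \<Longrightarrow> continuous_on {p..q} (k i)"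
    and dist: "\<And>i j. i \<in> S \<Longrightarrow> j \<in> S \<Longrightarrow> integral {p..q} (\<lambda>t. \<bar>k i t - k j t\<bar>) \<le> 2 * C"
  shows "integral {p..q} (\<lambda>t. \<bar>\<Sum>i\<in>S. c i * k i t\<bar>) \<le> C * (\<Sum>i\<in>S. \<bar>c i\<bar>)"
proof -
  define P where "P i = max 0 (c i)" for i
  define N where "N i = max 0 (- c i)" for i
  have PN: "c i = P i - N i" "\<bar>c i\<bar> = P i + N i" "0 \<le> P i" "0 \<le> N i" for i
    by (auto simp: P_def N_def)
  define s where "s = sum P S"
  have s: "sum N S = s"
    using c0 by (simp add: PN(1) sum_subtractf s_def)
  have s0: "0 \<le> s" by (simp add: s_def sum_nonneg PN)
  have l1: "(\<Sum>i\<in>S. \<bar>c i\<bar>) = 2 * s"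
    using s by (simp add: PN(2) sum.distrib s_def)
  have int: "(\<lambda>t. \<bar>k i t - k j t\<bar>) integrable_on {p..q}" if "i \<in> S" "j \<in> S" for i j
    using that by (intro integrable_continuous_interval continuous_intros cont)
  have contsum: "continuous_on {p..q} (\<lambda>t. \<Sum>i\<in>S. c i * k i t)"
    by (intro continuous_intros cont)
  have pointwise: "s * \<bar>\<Sum>i\<in>S. c i * k i t\<bar> \<le> (\<Sum>i\<in>S. \<Sum>j\<in>S. P i * N j * \<bar>k i t - k j t\<bar>)" for t
  proof -
    have "(\<Sum>i\<in>S. \<Sum>j\<in>S. P i * N j * (k i t - k j t))
        = (\<Sum>i\<in>S. P i * k i t) * sum N S - sum P S * (\<Sum>j\<in>S. N j * k j t)"
      unfolding sum_product sum_subtractf[symmetric] right_diff_distrib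
      by (intro sum.cong refl) simp
    also have "\<dots> = s * (\<Sum>i\<in>S. c i * k i t)"
      by (simp add: s PN(1) left_diff_distrib sum_subtractf right_diff_distrib mult.commute flip: s_def)
    finally have "s * \<bar>\<Sum>i\<in>S. c i * k i t\<bar> = \<bar>\<Sum>i\<in>S. \<Sum>j\<in>S. P i * N j * (k i t - k j t)\<bar>"
      using s0 by (simp add: abs_mult)
    also have "\<dots> \<le> (\<Sum>i\<in>S. \<Sum>j\<in>S. \<bar>P i * N j * (k i t - k j t)\<bar>)"
      by (intro order.trans[OF sum_abs] sum_mono) simp
    also have "\<dots> = (\<Sum>i\<in>S. \<Sum>j\<in>S. P i * N j * \<bar>k i t - k j t\<bar>)"
      by (simp add: abs_mult PN)
    finally show ?thesis .
  qed
  have "s * integral {p..q} (\<lambda>t. \<bar>\<Sum>i\<in>S. c i * k i t\<bar>)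
      = integral {p..q} (\<lambda>t. s * \<bar>\<Sum>i\<in>S. c i * k i t\<bar>)"
    by simp
  also have "\<dots> \<le> integral {p..q} (\<lambda>t. \<Sum>i\<in>S. \<Sum>j\<in>S. P i * N j * \<bar>k i t - k j t\<bar>)"
    using pointwise
    by (intro integral_le integrable_continuous_interval continuous_intros contsum cont) auto
  also have "\<dots> = (\<Sum>i\<in>S. \<Sum>j\<in>S. P i * N j * integral {p..q} (\<lambda>t. \<bar>k i t - k j t\<bar>))"
    by (intro integral_unique has_integral_sum assms(1) has_integral_mult_right integrable_integral int)
  also have "\<dots> \<le> (\<Sum>i\<in>S. \<Sum>j\<in>S. P i * N j * (2 * C))"
    by (intro sum_mono mult_left_mono dist) (auto simp: PN)
  also have "\<dots> = s * (2 * C * s)"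
    by (simp add: s sum_product[symmetric] sum_distrib_right[symmetric] s_def[symmetric])
  finally have main: "s * integral {p..q} (\<lambda>t. \<bar>\<Sum>i\<in>S. c i * k i t\<bar>) \<le> s * (2 * C * s)" .
  show ?thesis
  proof (cases "s = 0")
    case True
    then have "(\<Sum>i\<in>S. \<bar>c i\<bar>) = 0" using l1 by simp
    then have "\<And>i. i \<in> S \<Longrightarrow> c i = 0"
      using assms(1) by (simp add: sum_nonneg_eq_0_iff)
    then show ?thesis by simp
  next
    case False
    with main s0 show ?thesis by (simp add: l1 mult_ac)
  qed
qed

text \<open>The complex case reduces to the real one since the modulus of \<open>z\<close> is a fixed multiple of the
  mean of \<open>\<bar>Re (e\<^sup>i\<^sup>\<theta> z)\<bar>\<close> over \<open>\<theta>\<close>, so no constant is lost.\<close>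

lemma zero_sum_L1_bound:
  fixes k :: "'i \<Rightarrow> real \<Rightarrow> real" and c :: "'i \<Rightarrow> complex"
  assumes "finite S" and c0: "sum c S = 0"
    and cont: "\<And>i. i \<in> S \<Longrightarrow> continuous_on {p..q} (k i)"
    and dist: "\<And>i j. i \<in> S \<Longrightarrow> j \<in> S \<Longrightarrow> integral {p..q} (\<lambda>t. \<bar>k i t - k j t\<bar>) \<le> 2 * C"
  shows "integral {p..q} (\<lambda>t. cmod (\<Sum>i\<in>S. c i * k i t)) \<le> C * (\<Sum>i\<in>S. cmod (c i))"
proof -
  define B where "B = integral {0..2 * pi} (\<lambda>\<theta>. \<bar>cos \<theta>\<bar>)"
  define g where "g t = (\<Sum>i\<in>S. c i * k i t)" for t
  have contg: "continuous_on {p..q} g"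
    unfolding g_def by (intro continuous_intros cont)
  have Reg: "Re (cis \<theta> * g t) = (\<Sum>i\<in>S. Re (cis \<theta> * c i) * k i t)" for \<theta> t
    by (simp add: g_def sum_distrib_left Re_sum mult.assoc[symmetric])
  have cont2: "continuous_on (cbox (0, p) (2 * pi, q)) (\<lambda>(\<theta>, t). \<bar>Re (cis \<theta> * g t)\<bar>)"
    unfolding split_beta cbox_Pair_eq
    by (intro continuous_intros continuous_on_compose2[OF contg]) auto
  have "integral {p..q} (\<lambda>t. cmod (g t)) * B = integral {p..q} (\<lambda>t. cmod (g t) * B)"
    by simp
  also have "\<dots> = integral {p..q} (\<lambda>t. integral {0..2 * pi} (\<lambda>\<theta>. \<bar>Re (cis \<theta> * g t)\<bar>))"
    by (simp only: integral_abs_Re_cis B_def)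
  also have "\<dots> = integral {0..2 * pi} (\<lambda>\<theta>. integral {p..q} (\<lambda>t. \<bar>Re (cis \<theta> * g t)\<bar>))"
    using integral_swap_continuous[OF cont2] by simp
  also have "\<dots> \<le> integral {0..2 * pi} (\<lambda>\<theta>. C * (\<Sum>i\<in>S. \<bar>Re (cis \<theta> * c i)\<bar>))"
  proof (rule integral_le)
    have "continuous_on {0..2 * pi} (\<lambda>\<theta>. integral (cbox p q) (\<lambda>t. \<bar>Re (cis \<theta> * g t)\<bar>))"
      using cont2 by (intro integral_continuous_on_param) (simp add: cbox_Pair_eq)
    then show "(\<lambda>\<theta>. integral {p..q} (\<lambda>t. \<bar>Re (cis \<theta> * g t)\<bar>)) integrable_on {0..2 * pi}"
      by (intro integrable_continuous_interval) simp
    show "(\<lambda>\<theta>. C * (\<Sum>i\<in>S. \<bar>Re (cis \<theta> * c i)\<bar>)) integrable_on {0..2 * pi}"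
      by (intro integrable_continuous_interval continuous_intros)
    fix \<theta>
    \<comment> \<open>For each fixed angle the rotated real parts are again zero-sum real
      coefficients, so the real case applies with the same \<open>C\<close>.\<close>
    have "(\<Sum>i\<in>S. Re (cis \<theta> * c i)) = Re (cis \<theta> * sum c S)"
      by (simp only: Re_sum sum_distrib_left)
    then show "integral {p..q} (\<lambda>t. \<bar>Re (cis \<theta> * g t)\<bar>) \<le> C * (\<Sum>i\<in>S. \<bar>Re (cis \<theta> * c i)\<bar>)"
      unfolding Reg using c0
      by (intro zero_sum_L1_bound_real[OF assms(1)] cont dist) auto
  qed
  also have "\<dots> = C * (\<Sum>i\<in>S. integral {0..2 * pi} (\<lambda>\<theta>. \<bar>Re (cis \<theta> * c i)\<bar>))"
  proof -
    have "(\<lambda>\<theta>. \<bar>Re (cis \<theta> * z)\<bar>) integrable_on {0..2 * pi}" for z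
      by (intro integrable_continuous_interval continuous_intros)
    then show ?thesis
      by (simp only: integral_mult_right integral_sum[OF assms(1)])
  qed
  also have "\<dots> = C * (\<Sum>i\<in>S. cmod (c i)) * B"
    by (simp only: integral_abs_Re_cis B_def sum_distrib_right mult.assoc)
  finally show ?thesis
    using integral_abs_cos_pos by (simp add: B_def g_def)
qed

section \<open>Curve length\<close>

text \<open>A monotone \<open>g\<close> carries partitions to partitions, and the polygon stays the
  same.\<close>

lemma curve_length_compose_le:
  assumes "mono g"
  shows "curve_length (f \<circ> g) s t \<le> curve_length f (g s) (g t)"
  unfolding curve_length_def
proof (rule SUP_mono, clarify)
  fix n and \<tau> :: "nat \<Rightarrow> real"
  assume "mono \<tau>" "range \<tau> \<subseteq> {s..t}"
  then show "\<exists>m\<in>{(n, \<tau>). mono \<tau> \<and> range \<tau> \<subseteq> {g s..g t}}.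
      ennreal (\<Sum>i<n. dist ((f \<circ> g) (\<tau> i)) ((f \<circ> g) (\<tau> (Suc i))))
      \<le> (case m of (n, \<tau>) \<Rightarrow> ennreal (\<Sum>i<n. dist (f (\<tau> i)) (f (\<tau> (Suc i)))))"
    using assms by (intro bexI[of _ "(n, g \<circ> \<tau>)"]) (auto simp: mono_def image_subset_iff)
qed

lemma curve_length_compose:
  assumes "mono g" "mono h" "\<And>x. g (h x) = x" "\<And>x. h (g x) = x"
  shows "curve_length (f \<circ> g) s t = curve_length f (g s) (g t)"
proof (rule antisym[OF curve_length_compose_le[OF assms(1)]])
  have "curve_length f (g s) (g t) = curve_length ((f \<circ> g) \<circ> h) (g s) (g t)"
    by (simp add: comp_def assms(3))
  also have "\<dots> \<le> curve_length (f \<circ> g) (h (g s)) (h (g t))"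
    by (rule curve_length_compose_le[OF assms(2)])
  finally show "curve_length f (g s) (g t) \<le> curve_length (f \<circ> g) s t"
    by (simp add: assms(4))
qed

text \<open>Chords never exceed the increments of \<open>\<Lambda>\<close>. Conversely, a Lipschitz
  derivative makes each chord fall short of its increment by at most a multiple of the squared step,
  so the total deficit of equal partitions tends to 0.\<close>

lemma curve_length_smooth:
  fixes f D :: "real \<Rightarrow> complex"
  assumes f: "\<And>x. (f has_vector_derivative D x) (at x)"
    and lip: "\<And>x y. cmod (D x - D y) \<le> C * \<bar>x - y\<bar>"
    and \<Lambda>: "\<And>x. (\<Lambda> has_vector_derivative cmod (D x)) (at x)"
    and "u \<le> v"
  shows "curve_length f u v = ennreal (\<Lambda> v - \<Lambda> u)"
proof -
  have C: "0 \<le> C" using order.trans[OF norm_ge_zero lip[of 0 1]] by simp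
  have contf: "continuous_on S f" for S
    by (intro continuous_at_imp_continuous_on ballI has_vector_derivative_continuous[OF f])
  have cont\<Lambda>: "continuous_on S \<Lambda>" for S
    by (intro continuous_at_imp_continuous_on ballI has_vector_derivative_continuous[OF \<Lambda>])
  have upper: "dist (f x) (f y) \<le> \<Lambda> y - \<Lambda> x" if "x \<le> y" for x y
  proof (cases "x = y")
    case False
    with that have "norm (f y - f x) \<le> \<Lambda> y - \<Lambda> x"
      by (intro differentiable_bound_general[where f' = D and \<phi>' = "\<lambda>x. cmod (D x)"] contf cont\<Lambda> f \<Lambda>) auto
    then show ?thesis by (simp add: dist_norm norm_minus_commute)
  qed simp
  \<comment> \<open>The factor 2 collects two errors of size C h^2: chord against tangent vector,
    and increment of \<open>\<Lambda>\<close> against the initial speed.\<close>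
  have lower: "\<Lambda> y - \<Lambda> x - 2 * C * (y - x)\<^sup>2 \<le> dist (f x) (f y)" if "x \<le> y" for x y
  proof (cases "x = y")
    case False
    with that have "x < y" by simp
    define h where "h = y - x"
    have lin: "((\<lambda>t. C * h * t) has_vector_derivative C * h) (at t)" for t
      by (auto intro!: derivative_eq_intros simp flip: has_real_derivative_iff_has_vector_derivative)
    have lip': "cmod (D t - D x) \<le> C * h" if "x < t" "t < y" for t
      using lip[of t x] that C by (intro order.trans[OF lip] mult_left_mono) (auto simp: h_def)
    have "((\<lambda>t. f t - t *\<^sub>R D x) has_vector_derivative D t - D x) (at t)" for t
      by (auto intro!: derivative_eq_intros f)
    then have "norm ((f y - y *\<^sub>R D x) - (f x - x *\<^sub>R D x)) \<le> C * h * y - C * h * x"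
      using \<open>x < y\<close> lip' lin
      by (intro differentiable_bound_general[where f' = "\<lambda>t. D t - D x" and \<phi>' = "\<lambda>t. C * h"] continuous_intros contf) auto
    also have "(f y - y *\<^sub>R D x) - (f x - x *\<^sub>R D x) = (f y - f x) - h *\<^sub>R D x"
      by (simp add: h_def scaleR_diff_left)
    finally have 1: "norm ((f y - f x) - h *\<^sub>R D x) \<le> C * h\<^sup>2"
      by (simp add: h_def power2_eq_square algebra_simps)
    have "((\<lambda>t. \<Lambda> t - t * cmod (D x)) has_vector_derivative cmod (D t) - cmod (D x)) (at t)" for t
      by (auto intro!: derivative_eq_intros \<Lambda>)
    then have "norm ((\<Lambda> y - y * cmod (D x)) - (\<Lambda> x - x * cmod (D x))) \<le> C * h * y - C * h * x"
      using \<open>x < y\<close> lin order.trans[OF norm_triangle_ineq3 lip']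
      by (intro differentiable_bound_general[where f' = "\<lambda>t. cmod (D t) - cmod (D x)" and \<phi>' = "\<lambda>t. C * h"]
          continuous_intros cont\<Lambda>) auto
    also have "(\<Lambda> y - y * cmod (D x)) - (\<Lambda> x - x * cmod (D x)) = (\<Lambda> y - \<Lambda> x) - h * cmod (D x)"
      by (simp add: h_def algebra_simps)
    finally have 2: "\<bar>(\<Lambda> y - \<Lambda> x) - h * cmod (D x)\<bar> \<le> C * h\<^sup>2"
      by (simp add: h_def power2_eq_square algebra_simps)
    have "cmod (h *\<^sub>R D x) \<le> cmod (f y - f x) + norm ((f y - f x) - h *\<^sub>R D x)"
      by (metis norm_minus_commute norm_triangle_sub)
    moreover have "cmod (h *\<^sub>R D x) = h * cmod (D x)"
      using \<open>x < y\<close> by (simp add: h_def)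
    moreover have "dist (f x) (f y) = cmod (f y - f x)"
      by (simp add: dist_norm norm_minus_commute)
    ultimately show ?thesis
      using 1 2 unfolding h_def[symmetric] by linarith
  qed simp
  show ?thesis
  proof (rule antisym)
    show "curve_length f u v \<le> ennreal (\<Lambda> v - \<Lambda> u)"
      unfolding curve_length_def
    proof (rule SUP_least, clarify)
      fix n and \<tau> :: "nat \<Rightarrow> real"
      assume \<tau>: "mono \<tau>" "range \<tau> \<subseteq> {u..v}"
      have "(\<Sum>i<n. dist (f (\<tau> i)) (f (\<tau> (Suc i)))) \<le> (\<Sum>i<n. \<Lambda> (\<tau> (Suc i)) - \<Lambda> (\<tau> i))"
        using \<tau>(1) by (intro sum_mono upper) (simp add: monoD)
      also have "\<dots> = \<Lambda> (\<tau> n) - \<Lambda> (\<tau> 0)"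
        by (rule sum_lessThan_telescope)
      also have "\<dots> \<le> \<Lambda> v - \<Lambda> u"
      proof -
        have "u \<le> \<tau> 0" "\<tau> n \<le> v"
          using \<tau>(2) by (auto simp: image_subset_iff)
        from this[THEN upper] show ?thesis
          using zero_le_dist[of "f u" "f (\<tau> 0)"] zero_le_dist[of "f (\<tau> n)" "f v"] by linarith
      qed
      finally show "ennreal (\<Sum>i<n. dist (f (\<tau> i)) (f (\<tau> (Suc i)))) \<le> ennreal (\<Lambda> v - \<Lambda> u)"
        by (rule ennreal_leI)
    qed
    have approx: "ennreal (\<Lambda> v - \<Lambda> u - 2 * C * (v - u)\<^sup>2 / Suc n) \<le> curve_length f u v" for n
    proof -
      let ?N = "Suc n"
      \<comment> \<open>\<open>curve_length\<close> takes infinite monotone sequences with range in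
        the interval, so the partition is frozen at \<open>v\<close> from index \<open>?N\<close>
        on; \<open>Suc n\<close> keeps the number of pieces positive.\<close>
      define \<tau> where "\<tau> i = u + (v - u) * (min i ?N / ?N)" for i
      have step: "\<tau> (Suc i) - \<tau> i = (v - u) / ?N" if "i < ?N" for i
      proof -
        have "\<tau> (Suc i) - \<tau> i = (v - u) * (real (Suc i) / ?N - real i / ?N)"
          using that by (simp add: \<tau>_def right_diff_distrib min_def)
        also have "real (Suc i) / ?N - real i / ?N = 1 / ?N"
          by (simp flip: diff_divide_distrib)
        finally show ?thesis by simp
      qed
      have "mono \<tau>"
        using \<open>u \<le> v\<close> unfolding mono_def \<tau>_def
        by (auto intro!: mult_left_mono divide_right_mono)
      moreover have "range \<tau> \<subseteq> {u..v}"
      proof safe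
        fix i
        define x where "x = real (min i ?N) / ?N"
        have "0 \<le> x" "x \<le> 1"
          by (auto simp: x_def divide_le_eq_1)
        then have "0 \<le> (v - u) * x" "(v - u) * x \<le> (v - u) * 1"
          using \<open>u \<le> v\<close> by (simp, intro mult_left_mono) auto
        then show "\<tau> i \<in> {u..v}" unfolding \<tau>_def x_def[symmetric] by simp
      qed
      ultimately have le: "ennreal (\<Sum>i<?N. dist (f (\<tau> i)) (f (\<tau> (Suc i)))) \<le> curve_length f u v"
        unfolding curve_length_def by (intro SUP_upper2[of "(?N, \<tau>)"]) auto
      have ends: "\<tau> ?N = v" "\<tau> 0 = u"
        by (simp_all add: \<tau>_def del: of_nat_Suc)
      have "(\<Sum>i<?N. \<Lambda> (\<tau> (Suc i)) - \<Lambda> (\<tau> i)) = \<Lambda> v - \<Lambda> u"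
        by (simp only: sum_lessThan_telescope[of "\<lambda>i. \<Lambda> (\<tau> i)"] ends)
      moreover have "(\<Sum>i<?N. 2 * C * ((v - u) / ?N)\<^sup>2) = 2 * C * (v - u)\<^sup>2 / ?N"
        by (simp add: power2_eq_square del: of_nat_Suc sum.lessThan_Suc)
      ultimately have "\<Lambda> v - \<Lambda> u - 2 * C * (v - u)\<^sup>2 / ?N
          = (\<Sum>i<?N. \<Lambda> (\<tau> (Suc i)) - \<Lambda> (\<tau> i)) - (\<Sum>i<?N. 2 * C * ((v - u) / ?N)\<^sup>2)"
        by (simp only:)
      also have "\<dots> = (\<Sum>i<?N. \<Lambda> (\<tau> (Suc i)) - \<Lambda> (\<tau> i) - 2 * C * (\<tau> (Suc i) - \<tau> i)\<^sup>2)"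
        unfolding sum_subtractf[symmetric] by (intro sum.cong refl) (simp add: step)
      also have "\<dots> \<le> (\<Sum>i<?N. dist (f (\<tau> i)) (f (\<tau> (Suc i))))"
        using \<open>mono \<tau>\<close> by (intro sum_mono lower) (simp add: monoD)
      finally show ?thesis
        by (intro order.trans[OF ennreal_leI le])
    qed
    have "(\<lambda>n. ennreal (\<Lambda> v - \<Lambda> u - 2 * C * (v - u)\<^sup>2 / Suc n)) \<longlonglongrightarrow> ennreal (\<Lambda> v - \<Lambda> u - 0)"
      by (intro tendsto_ennrealI tendsto_intros LIMSEQ_Suc lim_const_over_n)
    then show "ennreal (\<Lambda> v - \<Lambda> u) \<le> curve_length f u v"
      using approx by (intro tendsto_upperbound[OF _ always_eventually]) auto
  qed
qed

section \<open>Functions that gain a fixed amount over each period\<close>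

lemma additively_periodic_nat:
  fixes f :: "real \<Rightarrow> real"
  assumes "\<And>x. f (x + p) = f x + q"
  shows "f (x + real n * p) = f x + real n * q"
proof (induction n)
  case (Suc n)
  have "f (x + real (Suc n) * p) = f ((x + real n * p) + p)"
    by (simp add: algebra_simps)
  then show ?case
    unfolding assms Suc by (simp add: algebra_simps)
qed simp

lemma additively_periodic_int:
  fixes f :: "real \<Rightarrow> real"
  assumes "\<And>x. f (x + p) = f x + q"
  shows "f (x + of_int n * p) = f x + of_int n * q"
proof (cases n rule: int_cases2)
  case (nonneg m)
  then show ?thesis using additively_periodic_nat[of f p q x m] assms by simp
next
  case (nonpos m)
  then show ?thesis
    using additively_periodic_nat[of f p q "x - real m * p" m] assms by simp
qed

text \<open>The values at multiples of \<open>p\<close> are unbounded in both directions; the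
  intermediate value property fills the gaps.\<close>

lemma additively_periodic_surj:
  fixes f :: "real \<Rightarrow> real"
  assumes per: "\<And>x. f (x + p) = f x + q" and "0 < q" and cont: "continuous_on UNIV f"
  shows "surj f"
  unfolding surj_def
proof
  fix y
  obtain n where n: "\<bar>y - f 0\<bar> < real n * q"
    using ex_less_of_nat_mult[OF \<open>0 < q\<close>] by blast
  have "f (real n * p) = f 0 + real n * q"
    using additively_periodic_nat[of f p q 0 n] per by simp
  moreover have "f (- (real n * p)) = f 0 - real n * q"
    using additively_periodic_nat[of f p q "- (real n * p)" n] per by simp
  ultimately have "f (- (real n * p)) \<le> y" "y \<le> f (real n * p)"
    using n by auto
  moreover have "connected (range f)"
    using cont connected_UNIV by (rule connected_continuous_image)
  ultimately have "y \<in> range f"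
    using connectedD_interval[of "range f"] by blast
  then show "\<exists>x. y = f x" by blast
qed

lemma strict_mono_inverse_mono:
  fixes f g :: "real \<Rightarrow> real"
  assumes "strict_mono f" "\<And>x. f (g x) = x"
  shows "mono g"
proof (rule monoI)
  fix x y :: real
  assume "x \<le> y"
  then have "f (g x) \<le> f (g y)" by (simp only: assms(2))
  then show "g x \<le> g y" by (simp only: strict_mono_less_eq[OF assms(1)])
qed

lemma dist_le_curve_length:
  assumes "s \<le> t"
  shows "ennreal (dist (\<gamma> s) (\<gamma> t)) \<le> curve_length \<gamma> s t"
  unfolding curve_length_def
  by (rule SUP_upper2[of "(1, \<lambda>i. if i = 0 then s else t)"]) (use assms in \<open>auto simp: mono_def\<close>)

section \<open>Arclength parametrizations of an ellipse\<close>

locale ellipse_axes =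
  fixes a b :: real
  assumes pos: "0 < a" "0 < b"
begin

definition stretch :: "complex \<Rightarrow> complex" where
  "stretch z = Complex (a * Re z) (b * Im z)"

definition ellipse_point :: "real \<Rightarrow> complex" where
  "ellipse_point t = Complex (a * cos t) (b * sin t)"

definition ellipse_velocity :: "real \<Rightarrow> complex" where
  "ellipse_velocity t = Complex (- a * sin t) (b * cos t)"

abbreviation speed :: "real \<Rightarrow> real" where
  "speed t \<equiv> cmod (ellipse_velocity t)"

lemma linear_stretch: "linear stretch"
  by (rule linearI) (simp_all add: stretch_def complex_eq_iff algebra_simps)

lemma bij_stretch: "bij stretch"
proof (rule o_bij[of "\<lambda>z. Complex (Re z / a) (Im z / b)"])
qed (use pos in \<open>auto simp: stretch_def fun_eq_iff complex_eq_iff\<close>)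

lemma ellipse_eq_image: "ellipse a b = stretch ` cball 0 1"
proof -
  have "stretch z \<in> ellipse a b \<longleftrightarrow> z \<in> cball 0 1" for z
    using pos by (simp add: stretch_def ellipse_def cmod_def power_mult_distrib)
  then have "w \<in> ellipse a b \<longleftrightarrow> w \<in> stretch ` cball 0 1" for w
    using surjD[OF bij_is_surj[OF bij_stretch], of w] inj_image_mem_iff[OF bij_is_inj[OF bij_stretch]]
    by blast
  then show ?thesis by blast
qed

lemma interior_ellipse: "interior (ellipse a b) = stretch ` ball 0 1"
  unfolding ellipse_eq_image
  by (simp add: interior_bijective_linear_image[OF linear_stretch bij_stretch])

lemma zero_in_interior_ellipse: "0 \<in> interior (ellipse a b)"
  unfolding interior_ellipse by (auto simp: stretch_def complex_eq_iff intro!: image_eqI[of _ _ 0])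

lemma frontier_ellipse: "frontier (ellipse a b) = range ellipse_point"
proof -
  have "compact (ellipse a b)"
    unfolding ellipse_eq_image
    by (intro compact_continuous_image linear_continuous_on linear_conv_bounded_linear[THEN iffD1] linear_stretch)
       simp
  then have "closure (ellipse a b) = stretch ` cball 0 1"
    by (simp add: compact_imp_closed flip: ellipse_eq_image)
  then have "frontier (ellipse a b) = stretch ` (cball 0 1 - ball 0 1)"
    unfolding frontier_def interior_ellipse
    using bij_stretch by (simp add: image_set_diff bij_def)
  also have "cball 0 1 - ball 0 1 = sphere (0::complex) 1"
    by auto
  also have "sphere 0 1 = range cis"
  proof -
    have "cmod z = 1 \<Longrightarrow> z \<in> range cis" for z
      using rcis_cmod_Arg[of z] by (metis mult_1 of_real_1 rangeI rcis_def)
    then show ?thesis by auto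
  qed
  also have "stretch ` range cis = range ellipse_point"
    by (simp add: image_image stretch_def ellipse_point_def)
  finally show ?thesis .
qed

lemma ellipse_point_deriv: "(ellipse_point has_vector_derivative ellipse_velocity t) (at t)"
  unfolding has_vector_derivative_complex_iff ellipse_point_def ellipse_velocity_def
  by (auto intro!: derivative_eq_intros)

lemma ellipse_velocity_Lipschitz:
  "cmod (ellipse_velocity x - ellipse_velocity y) \<le> (a + b) * \<bar>x - y\<bar>"
proof -
  have "\<bar>sin ((x - y) / 2) * c\<bar> \<le> \<bar>x - y\<bar> / 2" if "\<bar>c\<bar> \<le> 1" for c
    using mult_mono[OF abs_sin_x_le_abs_x[of "(x - y) / 2"] that] by (simp add: abs_mult)
  note half = this
  have sin_flip: "sin ((y - x) / 2) = - sin ((x - y) / 2)"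
  proof -
    have e: "(y - x) / 2 = - ((x - y) / 2)" by (simp add: field_simps)
    show ?thesis unfolding e by simp
  qed
  from half[of "cos ((x + y) / 2)"] half[of "sin ((x + y) / 2)"]
  have "\<bar>sin x - sin y\<bar> \<le> \<bar>x - y\<bar>" "\<bar>cos x - cos y\<bar> \<le> \<bar>x - y\<bar>"
    unfolding sin_diff_sin cos_diff_cos sin_flip
    by (simp_all add: abs_mult mult_ac)
  from add_mono[OF mult_left_mono[OF this(1) less_imp_le[OF pos(1)]] mult_left_mono[OF this(2) less_imp_le[OF pos(2)]]]
  have "\<bar>a * (sin x - sin y)\<bar> + \<bar>b * (cos x - cos y)\<bar> \<le> (a + b) * \<bar>x - y\<bar>"
    by (simp only: abs_mult abs_of_pos[OF pos(1)] abs_of_pos[OF pos(2)] distrib_right)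
  moreover have "cmod (ellipse_velocity x - ellipse_velocity y)
      \<le> \<bar>a * (sin x - sin y)\<bar> + \<bar>b * (cos x - cos y)\<bar>"
  proof -
    have "ellipse_velocity x - ellipse_velocity y
        = Complex (- (a * (sin x - sin y))) (b * (cos x - cos y))"
      by (simp add: ellipse_velocity_def complex_eq_iff algebra_simps)
    then show ?thesis
      using cmod_le[of "ellipse_velocity x - ellipse_velocity y"] by simp
  qed
  ultimately show ?thesis by linarith
qed

lemma continuous_on_ellipse_point [continuous_intros]:
  fixes f :: "'a::t2_space \<Rightarrow> real"
  shows
  "continuous_on S f \<Longrightarrow> continuous_on S (\<lambda>x. ellipse_point (f x))"
  unfolding ellipse_point_def by (intro continuous_intros)

lemma continuous_on_ellipse_velocity [continuous_intros]:
  fixes f :: "'a::t2_space \<Rightarrow> real"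
  shows
  "continuous_on S f \<Longrightarrow> continuous_on S (\<lambda>x. ellipse_velocity (f x))"
  unfolding ellipse_velocity_def by (intro continuous_intros)

lemma speed_pos: "0 < speed t"
proof -
  have "\<not> (sin t = 0 \<and> cos t = 0)"
    using sin_zero_abs_cos_one[of t] by auto
  then show ?thesis
    using pos by (auto simp: ellipse_velocity_def complex_eq_iff)
qed

lemma ellipse_point_eq_iff:
  "ellipse_point s = ellipse_point t \<longleftrightarrow> (\<exists>n::int. s = t + of_int n * (2 * pi))"
  using pos sin_cos_eq_iff[of s t] by (auto simp: ellipse_point_def mult_ac)

text \<open>The straight homotopy to the unit circle at equal angle avoids 0: it only multiplies
  cosine and sine by positive factors. On the circle the winding number is read off the increment of
  the exponent.\<close>

lemma winding_number_ellipse: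
  assumes cont: "continuous_on UNIV \<phi>" and per: "\<phi> L = \<phi> 0 + of_int k * (2 * pi)"
  shows "winding_number (\<lambda>t. ellipse_point (\<phi> (L * t))) 0 = of_int k"
proof -
  define p where "p t = \<i> * of_real (\<phi> (L * t))" for t
  let ?e = "\<lambda>t. ellipse_point (\<phi> (L * t))"
  have c: "continuous_on S (\<lambda>t. \<phi> (L * t))" for S
    by (intro continuous_on_compose2[OF cont] continuous_intros) auto
  have exp_p: "exp (p t) = cis (\<phi> (L * t))" for t
    by (simp add: p_def cis_conv_exp)
  have "homotopic_loops (- {0}) ?e (exp \<circ> p)"
  proof (rule homotopic_loops_linear)
    show "path ?e" "path (exp \<circ> p)"
      unfolding path_def p_def o_def by (intro continuous_intros c)+
    show "pathfinish ?e = pathstart ?e"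
      by (auto simp: pathfinish_def pathstart_def ellipse_point_eq_iff per)
    have "cis (\<phi> L) = cis (\<phi> 0)"
      using sin_cos_eq_iff[of "\<phi> L" "\<phi> 0"] per by (auto simp: cis.ctr mult_ac)
    then show "pathfinish (exp \<circ> p) = pathstart (exp \<circ> p)"
      by (simp add: pathfinish_def pathstart_def exp_p)
    fix t
    show "closed_segment (?e t) ((exp \<circ> p) t) \<subseteq> - {0}"
    proof clarsimp
      let ?x = "\<phi> (L * t)"
      assume "0 \<in> closed_segment (?e t) (exp (p t))"
      then obtain u where u: "0 \<le> u" "u \<le> 1" "0 = (1 - u) *\<^sub>R ellipse_point ?x + u *\<^sub>R cis ?x"
        by (auto simp: exp_p closed_segment_def)
      then have "((1 - u) * a + u) * cos ?x = 0" "((1 - u) * b + u) * sin ?x = 0"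
        by (simp_all add: ellipse_point_def complex_eq_iff algebra_simps)
      moreover have "0 < (1 - u) * c + u" if "0 < c" for c
        using u that by (cases "u = 0") (auto simp: add_nonneg_pos)
      from this[OF pos(1)] this[OF pos(2)]
      have "(1 - u) * a + u \<noteq> 0" "(1 - u) * b + u \<noteq> 0" by simp_all
      ultimately have "cos ?x = 0" "sin ?x = 0" by simp_all
      then show False using sin_cos_squared_add[of ?x] by simp
    qed
  qed
  then have "winding_number ?e 0 = winding_number (exp \<circ> p) 0"
    by (rule winding_number_homotopic_loops)
  also have "\<dots> = (pathfinish p - pathstart p) / (2 * of_real pi * \<i>)"
    by (rule winding_number_compose_exp) (unfold path_def p_def, intro continuous_intros c)
  also have "\<dots> = of_int k"
    by (simp add: pathfinish_def pathstart_def p_def per field_simps)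
  finally show ?thesis .
qed

text \<open>\<open>\<Lambda>\<close> is arclength as a function of the angle, \<open>\<psi>\<close>
  its inverse and \<open>L\<close> the length of one turn. Positive speed gives monotonicity, and
  periodic speed gives the additive period.\<close>

lemma ellipse_arclength_function:
  obtains \<Lambda> \<psi> L where "0 < L" "\<And>t. (\<Lambda> has_vector_derivative speed t) (at t)"
    "strict_mono \<Lambda>" "\<And>s. \<Lambda> (\<psi> s) = s" "\<And>t. \<psi> (\<Lambda> t) = t"
    "\<And>s. (\<psi> has_real_derivative 1 / speed (\<psi> s)) (at s)" "\<And>s. \<psi> (s + L) = \<psi> s + 2 * pi"
proof -
  have "continuous_on UNIV speed"
    by (intro continuous_intros)
  then obtain \<Lambda> where \<Lambda>: "\<And>t. (\<Lambda> has_vector_derivative speed t) (at t)"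
    using antiderivative_on_line by blast
  then have \<Lambda>': "\<And>t. (\<Lambda> has_real_derivative speed t) (at t)"
    by (simp add: has_real_derivative_iff_has_vector_derivative)
  have mono: "strict_mono \<Lambda>"
  proof (rule strict_monoI)
    show "\<Lambda> s < \<Lambda> t" if "s < t" for s t
      by (rule DERIV_pos_imp_increasing[OF that]) (use \<Lambda>' speed_pos in blast)
  qed
  have cont: "continuous_on UNIV \<Lambda>"
    by (intro continuous_at_imp_continuous_on ballI has_vector_derivative_continuous[OF \<Lambda>])
  define L where "L = \<Lambda> (2 * pi) - \<Lambda> 0"
  have "((\<lambda>t. \<Lambda> (t + 2 * pi) - \<Lambda> t) has_vector_derivative speed (t + 2 * pi) - speed t) (at t)" for t
    by (intro has_vector_derivative_diff has_vector_derivative_shift \<Lambda>)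
  then have "((\<lambda>t. \<Lambda> (t + 2 * pi) - \<Lambda> t) has_vector_derivative 0) (at t within UNIV)" for t
    by (simp add: ellipse_velocity_def)
  then obtain k where k: "\<And>t. \<Lambda> (t + 2 * pi) - \<Lambda> t = k"
    using has_vector_derivative_zero_constant[of UNIV] by auto
  have per: "\<Lambda> (t + 2 * pi) = \<Lambda> t + L" for t
    using k[of t] k[of 0] by (simp add: L_def)
  have "0 < L"
    using mono by (simp add: L_def strict_mono_less)
  have "surj \<Lambda>"
    by (rule additively_periodic_surj[OF per \<open>0 < L\<close> cont])
  define \<psi> where "\<psi> = inv \<Lambda>"
  have inv: "\<Lambda> (\<psi> s) = s" "\<psi> (\<Lambda> t) = t" for s t
    using \<open>surj \<Lambda>\<close> strict_mono_imp_inj_on[OF mono] by (simp_all add: \<psi>_def surj_f_inv_f)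
  have "isCont \<psi> s" for s
    using isCont_inverse_function[of 1 "\<psi> s" \<psi> \<Lambda>] has_vector_derivative_continuous[OF \<Lambda>]
    by (simp add: inv)
  then have "(\<psi> has_real_derivative inverse (speed (\<psi> s))) (at s)" for s
    using \<Lambda>' speed_pos[of "\<psi> s"]
    by (intro DERIV_inverse_function[where f = \<Lambda> and a = "s - 1" and b = "s + 1"]) (auto simp: inv)
  moreover have "\<psi> (s + L) = \<psi> s + 2 * pi" for s
    using per[of "\<psi> s"] inv by metis
  ultimately show ?thesis
    using that[OF \<open>0 < L\<close> \<Lambda> mono inv] by (simp add: inverse_eq_divide)
qed

lemma curve_length_ellipse:
  assumes "\<And>t. (\<Lambda> has_vector_derivative speed t) (at t)" "u \<le> v"
  shows "curve_length ellipse_point u v = ennreal (\<Lambda> v - \<Lambda> u)"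
  using ellipse_point_deriv ellipse_velocity_Lipschitz assms by (rule curve_length_smooth)

text \<open>\<open>perimeter\<close> and \<open>bdry\<close> are defined by choice; this witness
  makes their defining property available.\<close>

lemma ellipse_arclength_param_exists: "\<exists>L \<gamma>. arclength_param (ellipse a b) L \<gamma>"
proof -
  obtain \<Lambda> \<psi> L where L: "0 < L" and \<Lambda>: "\<And>t. (\<Lambda> has_vector_derivative speed t) (at t)"
    and mono: "strict_mono \<Lambda>" and inv: "\<And>s. \<Lambda> (\<psi> s) = s" "\<And>t. \<psi> (\<Lambda> t) = t"
    and deriv: "\<And>s. (\<psi> has_real_derivative 1 / speed (\<psi> s)) (at s)"
    and per: "\<And>s. \<psi> (s + L) = \<psi> s + 2 * pi"
    by (rule ellipse_arclength_function) blast
  define \<gamma> where "\<gamma> = ellipse_point \<circ> \<psi>"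
  have mono\<psi>: "mono \<psi>" by (rule strict_mono_inverse_mono[OF mono inv(1)])
  have cont: "continuous_on UNIV \<psi>"
    by (intro continuous_at_imp_continuous_on ballI DERIV_isCont[OF deriv])
  have \<gamma>_per: "\<gamma> (s + L) = \<gamma> s" for s
    by (simp add: \<gamma>_def per ellipse_point_def)
  have \<gamma>_eq: "\<exists>n::int. s = t + of_int n * L" if "\<gamma> s = \<gamma> t" for s t
  proof -
    obtain n :: int where "\<psi> s = \<psi> t + of_int n * (2 * pi)"
      using \<open>\<gamma> s = \<gamma> t\<close> by (auto simp: \<gamma>_def ellipse_point_eq_iff)
    then have "\<psi> s = \<psi> (t + of_int n * L)"
      using additively_periodic_int[of \<psi> L "2 * pi" t n] per by simp
    then show ?thesis using inv(1) by metis
  qed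
  have "inj_on \<gamma> {0..<L}"
  proof (rule inj_onI)
    fix s t assume st: "s \<in> {0..<L}" "t \<in> {0..<L}" "\<gamma> s = \<gamma> t"
    obtain n :: int where n: "s = t + of_int n * L" using \<gamma>_eq[OF st(3)] by blast
    then have "\<bar>of_int n * L\<bar> < 1 * L" using st by auto
    then have "\<bar>real_of_int n\<bar> < 1" using L by (simp add: abs_mult)
    then have "n = 0" by linarith
    then show "s = t" using n by simp
  qed
  moreover have "\<gamma> ` {0..<L} = frontier (ellipse a b)"
  proof -
    have "ellipse_point t \<in> \<gamma> ` {0..<L}" for t
    proof -
      define n where "n = \<lfloor>\<Lambda> t / L\<rfloor>"
      define s where "s = \<Lambda> t - of_int n * L"
      have "0 \<le> s" "s < L"
        using L floor_divide_lower[OF L, of "\<Lambda> t"] floor_divide_upper[OF L, of "\<Lambda> t"]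
        by (auto simp: s_def n_def algebra_simps)
      moreover have "\<psi> (s + of_int n * L) = \<psi> s + of_int n * (2 * pi)"
        using additively_periodic_int[of \<psi> L "2 * pi"] per by blast
      then have "t = \<psi> s + of_int n * (2 * pi)"
        by (simp add: s_def inv)
      then have "ellipse_point t = \<gamma> s"
        by (auto simp: \<gamma>_def ellipse_point_eq_iff)
      ultimately show ?thesis by auto
    qed
    then show ?thesis
      unfolding frontier_ellipse by (auto simp: \<gamma>_def)
  qed
  moreover have "curve_length \<gamma> s t = ennreal (t - s)" if "s \<le> t" for s t
    unfolding \<gamma>_def curve_length_compose[OF mono\<psi> strict_mono_mono[OF mono] inv(2) inv(1)]
    using curve_length_ellipse[OF \<Lambda>, of "\<psi> s" "\<psi> t"] monoD[OF mono\<psi> that] by (simp add: inv)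
  \<comment> \<open>The interior is connected and disjoint from the curve, so evaluating the winding
    number at the centre 0 suffices.\<close>
  moreover have "winding_number (\<lambda>t. \<gamma> (L * t)) z = 1" if z: "z \<in> interior (ellipse a b)" for z
  proof -
    let ?p = "\<lambda>t. \<gamma> (L * t)"
    have "continuous_on UNIV \<gamma>"
      unfolding \<gamma>_def o_def by (intro continuous_intros cont)
    then have "path ?p"
      unfolding path_def by (rule continuous_on_compose2) (auto intro!: continuous_intros)
    moreover have "pathfinish ?p = pathstart ?p"
      using \<gamma>_per[of 0] by (simp add: pathfinish_def pathstart_def)
    moreover have "connected (interior (ellipse a b))"
      unfolding interior_ellipse
      by (intro connected_continuous_image linear_continuous_on linear_conv_bounded_linear[THEN iffD1] linear_stretch) simp
    moreover have "interior (ellipse a b) \<inter> path_image ?p = {}"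
      using frontier_ellipse by (auto simp: path_image_def \<gamma>_def frontier_def)
    ultimately have "winding_number ?p constant_on interior (ellipse a b)"
      by (rule winding_number_constant)
    then have "winding_number ?p z = winding_number ?p 0"
      using z zero_in_interior_ellipse by (auto simp: constant_on_def)
    also have "\<dots> = 1"
      using winding_number_ellipse[OF cont, of L 1] per[of 0] by (simp add: \<gamma>_def)
    finally show ?thesis .
  qed
  ultimately have "arclength_param (ellipse a b) L \<gamma>"
    using L \<gamma>_per by (simp add: arclength_param_def)
  then show ?thesis by blast
qed

section \<open>Structure of an arbitrary arclength parametrization\<close>

lemma arclength_param_periodic:
  assumes "arclength_param (ellipse a b) L \<gamma>"
  shows "\<gamma> (s + of_int n * L) = \<gamma> s"
proof -
  have per: "\<gamma> (s + L) = \<gamma> s" for s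
    using assms by (simp add: arclength_param_def)
  have nat: "\<gamma> (s + real m * L) = \<gamma> s" for m s
  proof (induction m)
    case (Suc m)
    have "\<gamma> (s + real (Suc m) * L) = \<gamma> ((s + real m * L) + L)"
      by (simp add: algebra_simps)
    then show ?case unfolding per Suc .
  qed simp
  show ?thesis
  proof (cases n rule: int_cases2)
    case (nonneg m)
    then show ?thesis using nat by simp
  next
    case (nonpos m)
    then show ?thesis using nat[of "s - real m * L" m] by simp
  qed
qed

lemma arclength_param_eqD:
  assumes param: "arclength_param (ellipse a b) L \<gamma>" and eq: "\<gamma> s = \<gamma> t"
  shows "\<exists>n::int. s = t + of_int n * L"
proof -
  have L: "0 < L" and inj: "inj_on \<gamma> {0..<L}"
    using param by (simp_all add: arclength_param_def)
  define r where "r s = s - of_int \<lfloor>s / L\<rfloor> * L" for s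
  have r: "r s \<in> {0..<L}" for s
    using floor_divide_lower[OF L, of s] floor_divide_upper[OF L, of s]
    by (simp add: r_def algebra_simps)
  have s_eq: "s = r s + of_int \<lfloor>s / L\<rfloor> * L" for s
    by (simp add: r_def)
  have "\<gamma> (r s) = \<gamma> s" for s
    using arclength_param_periodic[OF param, of "r s" "\<lfloor>s / L\<rfloor>"] s_eq[of s] by simp
  then have "\<gamma> (r s) = \<gamma> (r t)"
    using eq by simp
  then have "r s = r t"
    using inj_onD[OF inj _ r r] by blast
  then have "s = t + of_int (\<lfloor>s / L\<rfloor> - \<lfloor>t / L\<rfloor>) * L"
    using s_eq[of s] s_eq[of t] by (simp add: algebra_simps)
  then show ?thesis by blast
qed

lemma arclength_param_in_frontier:
  assumes param: "arclength_param (ellipse a b) L \<gamma>"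
  shows "\<gamma> s \<in> frontier (ellipse a b)"
proof -
  have L: "0 < L" and im: "\<gamma> ` {0..<L} = frontier (ellipse a b)"
    using param by (simp_all add: arclength_param_def)
  have "s - of_int \<lfloor>s / L\<rfloor> * L \<in> {0..<L}"
    using floor_divide_lower[OF L, of s] floor_divide_upper[OF L, of s]
    by (simp add: algebra_simps)
  moreover have "\<gamma> (s - of_int \<lfloor>s / L\<rfloor> * L) = \<gamma> s"
    using arclength_param_periodic[OF param, of s "- \<lfloor>s / L\<rfloor>"] by simp
  ultimately show ?thesis
    unfolding im[symmetric] by (metis imageI)
qed

text \<open>Continuity is not part of the definition; it follows because a chord is at most the
  length of its arc, which makes the curve 1-Lipschitz.\<close>

lemma arclength_param_continuous:
  assumes param: "arclength_param (ellipse a b) L \<gamma>"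
  shows "continuous_on UNIV \<gamma>"
proof -
  have le: "dist (\<gamma> s) (\<gamma> t) \<le> t - s" if "s \<le> t" for s t
    using dist_le_curve_length[OF that, of \<gamma>] param that
    by (simp add: arclength_param_def ennreal_le_iff)
  have "dist (\<gamma> s) (\<gamma> t) \<le> dist s t" for s t
    using le[of s t] le[of t s] by (cases "s \<le> t") (auto simp: dist_commute dist_real_def)
  then show ?thesis
    unfolding continuous_on_iff by (meson le_less_trans)
qed

text \<open>Undoing the axis scaling gives a curve \<open>e\<close> on the unit circle, whose
  continuous logarithm supplies the phase. The winding number fixes its increment over a period,
  injectivity of the curve makes it monotone, and comparison of arc lengths forces it to be a shift
  of the smooth function \<open>\<psi>\<close>.\<close>

lemma arclength_param_phase:
  assumes param: "arclength_param (ellipse a b) L \<gamma>"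
  obtains \<phi> where "\<And>s. \<gamma> s = ellipse_point (\<phi> s)"
    "\<And>s. (\<phi> has_real_derivative 1 / speed (\<phi> s)) (at s)" "\<And>s. \<phi> (s + L) = \<phi> s + 2 * pi"
proof -
  have L: "0 < L" and per\<gamma>: "\<And>s. \<gamma> (s + L) = \<gamma> s"
    and len: "\<And>s t. s \<le> t \<Longrightarrow> curve_length \<gamma> s t = ennreal (t - s)"
    and wind: "\<And>z. z \<in> interior (ellipse a b) \<Longrightarrow> winding_number (\<lambda>t. \<gamma> (L * t)) z = 1"
    using param by (simp_all add: arclength_param_def)
  define e where "e s = Complex (Re (\<gamma> s) / a) (Im (\<gamma> s) / b)" for s
  have cont_e: "continuous_on UNIV e"
    unfolding e_def[abs_def] using pos
    by (intro continuous_intros arclength_param_continuous[OF param]) auto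
  have cis_e: "\<exists>t. e s = cis t \<and> \<gamma> s = ellipse_point t" for s
    using arclength_param_in_frontier[OF param, of s] pos
    by (auto simp: frontier_ellipse e_def ellipse_point_def complex_eq_iff)
  then have norm_e: "cmod (e s) = 1" for s
    by (metis norm_cis)
  then have "e s \<noteq> 0" for s
    by (metis norm_zero zero_neq_one)
  then obtain g where g: "continuous_on UNIV g" "\<And>s. e s = exp (g s)"
    using continuous_logarithm_on_contractible[OF cont_e] contractible_UNIV by auto
  have "Re (g s) = 0" for s
    using norm_e[of s] by (simp add: g(2))
  then have g_eq: "g s = \<i> * of_real (Im (g s))" for s
    by (simp add: complex_eq_iff)
  define \<phi> where "\<phi> s = Im (g s)" for s
  have cont: "continuous_on UNIV \<phi>"
    unfolding \<phi>_def by (intro continuous_intros g)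
  have e_cis: "e s = cis (\<phi> s)" for s
    using g(2)[of s] g_eq[of s] by (simp add: \<phi>_def cis_conv_exp)
  have \<gamma>_eq: "\<gamma> s = ellipse_point (\<phi> s)" for s
    using e_cis[of s] pos by (simp add: e_def complex_eq_iff ellipse_point_def field_simps)
  define d where "d s = \<phi> (s + L) - \<phi> s" for s
  have d_int: "\<exists>k::int. d s = of_int k * (2 * pi)" for s
    using per\<gamma>[of s] by (auto simp: \<gamma>_eq ellipse_point_eq_iff d_def algebra_simps)
  \<comment> \<open>The increment over one period is continuous and lies in the discrete set of
    multiples of \<open>2 * pi\<close>.\<close>
  have "d constant_on UNIV"
  proof (rule continuous_discrete_range_constant)
    show "continuous_on UNIV d"
      unfolding d_def by (intro continuous_intros continuous_on_compose2[OF cont]) auto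
    fix x :: real
    have "2 * pi \<le> norm (d y - d x)" if "d y \<noteq> d x" for y
    proof -
      obtain k l :: int where kl: "d y = of_int k * (2 * pi)" "d x = of_int l * (2 * pi)"
        using d_int by metis
      with that have "1 \<le> \<bar>k - l\<bar>" by auto
      then have "1 \<le> \<bar>real_of_int (k - l)\<bar>" by linarith
      then have "1 * (2 * pi) \<le> \<bar>real_of_int (k - l)\<bar> * (2 * pi)"
        by (intro mult_right_mono) auto
      also have "\<dots> = norm (d y - d x)"
        by (simp add: kl abs_mult flip: left_diff_distrib)
      finally show ?thesis by simp
    qed
    then show "\<exists>e>0. \<forall>y. y \<in> UNIV \<and> d y \<noteq> d x \<longrightarrow> e \<le> norm (d y - d x)"
      by (intro exI[of _ "2 * pi"]) auto
  qed simp
  then obtain c where c: "\<And>s. d s = c" by (auto simp: constant_on_def)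
  obtain k :: int where k: "c = of_int k * (2 * pi)" using d_int[of 0] c by auto
  have "\<phi> L = \<phi> 0 + of_int k * (2 * pi)"
    using c[of 0] k by (simp add: d_def)
  \<comment> \<open>Orientation enters here: a clockwise curve would give
    \<open>k = -1\<close>.\<close>
  from winding_number_ellipse[OF cont this]
  have "of_int k = (1::complex)"
    using wind[of 0] by (simp add: \<gamma>_eq zero_in_interior_ellipse)
  then have "k = 1" by simp
  then have per: "\<phi> (s + L) = \<phi> s + 2 * pi" for s
    using c[of s] k by (simp add: d_def)
  have "inj \<phi>"
  proof (rule injI)
    fix s t assume st: "\<phi> s = \<phi> t"
    then have "\<gamma> s = \<gamma> t" by (simp add: \<gamma>_eq)
    then obtain n :: int where n: "s = t + of_int n * L"
      using arclength_param_eqD[OF param] by blast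
    have "\<phi> s = \<phi> t + of_int n * (2 * pi)"
      unfolding n using additively_periodic_int[of \<phi> L "2 * pi"] per by blast
    with st show "s = t" by (simp add: n)
  qed
  then have "strict_mono \<phi> \<or> strict_antimono_on UNIV \<phi>"
    using injective_eq_monotone_map[OF is_interval_univ cont] by simp
  moreover have "\<not> strict_antimono_on UNIV \<phi>"
    using per[of 0] L monotone_onD[of UNIV "(<)" "(>)" \<phi> 0 L] pi_gt_zero by auto
  ultimately have mono: "strict_mono \<phi>" by blast
  have "surj \<phi>"
    by (rule additively_periodic_surj[OF per _ cont]) simp
  then have inv: "\<phi> (inv \<phi> t) = t" "inv \<phi> (\<phi> s) = s" for s t
    using \<open>inj \<phi>\<close> by (simp_all add: surj_f_inv_f)
  obtain \<Lambda> \<psi> L' where \<Lambda>: "\<And>t. (\<Lambda> has_vector_derivative speed t) (at t)"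
    and mono\<Lambda>: "strict_mono \<Lambda>" and inv\<Lambda>: "\<And>t. \<psi> (\<Lambda> t) = t"
    and deriv: "\<And>s. (\<psi> has_real_derivative 1 / speed (\<psi> s)) (at s)"
    by (rule ellipse_arclength_function) blast
  \<comment> \<open>Two computations of one arc length: \<open>t - s\<close> from the
    parametrization, and the increment of \<open>\<Lambda>\<close> after the reparametrization by
    \<open>\<phi>\<close>.\<close>
  have \<Lambda>\<phi>: "\<Lambda> (\<phi> t) - \<Lambda> (\<phi> s) = t - s" if "s \<le> t" for s t
  proof -
    have le: "\<phi> s \<le> \<phi> t" using that mono by (simp add: strict_mono_less_eq)
    have "\<gamma> = ellipse_point \<circ> \<phi>" by (auto simp: \<gamma>_eq)
    then have "ennreal (t - s) = curve_length ellipse_point (\<phi> s) (\<phi> t)"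
      using len[OF that] curve_length_compose[OF strict_mono_mono[OF mono]
          strict_mono_inverse_mono[OF mono inv(1)] inv] by simp
    also have "\<dots> = ennreal (\<Lambda> (\<phi> t) - \<Lambda> (\<phi> s))"
      by (rule curve_length_ellipse[OF \<Lambda> le])
    finally show ?thesis
      using that le mono\<Lambda> by (simp add: strict_mono_less_eq)
  qed
  have "\<Lambda> (\<phi> s) = s + \<Lambda> (\<phi> 0)" for s
    using \<Lambda>\<phi>[of 0 s] \<Lambda>\<phi>[of s 0] by (cases "0 \<le> s") auto
  then obtain c where "\<And>s. \<Lambda> (\<phi> s) = s + c" by blast
  then have "\<phi> s = \<psi> (s + c)" for s
    by (metis inv\<Lambda>)
  then have \<phi>_eq: "\<phi> = (\<lambda>s. \<psi> (s + c))" by blast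
  have "((\<lambda>s. \<psi> (s + c)) has_vector_derivative 1 / speed (\<psi> (s + c))) (at s)" for s
    using deriv[of "s + c"]
    by (intro has_vector_derivative_shift) (simp add: has_real_derivative_iff_has_vector_derivative)
  then have "(\<phi> has_real_derivative 1 / speed (\<phi> s)) (at s)" for s
    by (simp add: \<phi>_eq has_real_derivative_iff_has_vector_derivative)
  then show ?thesis using that \<gamma>_eq per by blast
qed

section \<open>The Neumann-Poincare operator of an ellipse\<close>

abbreviation "\<Omega> \<equiv> ellipse a b"

text \<open>The ellipse point at angle t is (a + b)/2 times e^{it} + r e^{-it}, with
  \<open>r\<close> this ratio.\<close>

definition radius :: real where
  "radius = (a - b) / (a + b)"

lemma abs_radius_less_one: "\<bar>radius\<bar> < 1"
  using pos by (simp add: radius_def abs_less_iff minus_divide_left pos_divide_less_eq)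

text \<open>The cross product of the velocities at \<open>t\<close> and at the midpoint angle
  \<open>m\<close> is \<open>a * b * sin h\<close>, so the factor \<open>sin h\<close> of the chord
  cancels. What remains is a b / (2 pi |E'(m)|^2), and the double-angle form of |E'(m)|^2 is the
  Poisson denominator at \<open>t + u\<close> times (a + b)^2 / 4.\<close>

lemma kernel_eq_poisson:
  assumes "ellipse_point t \<noteq> ellipse_point u"
  shows "1 / pi * Re (- \<i> * ellipse_velocity t / (ellipse_point t - ellipse_point u))
    = poisson radius (t + u)"
proof -
  define m h where "m = (t + u) / 2" and "h = (t - u) / 2"
  have tu: "t = m + h" "u = m - h" "t + u = 2 * m"
    by (simp_all add: m_def h_def field_simps)
  have chord: "ellipse_point t - ellipse_point u = (2 * sin h) *\<^sub>R ellipse_velocity m"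
    by (simp add: tu ellipse_point_def ellipse_velocity_def complex_eq_iff
        cos_add cos_diff sin_add sin_diff algebra_simps)
  have nz: "sin h \<noteq> 0"
    using assms chord by auto
  let ?n = "a\<^sup>2 * (sin m)\<^sup>2 + b\<^sup>2 * (cos m)\<^sup>2"
  have n: "(cmod (ellipse_velocity m))\<^sup>2 = ?n"
    by (simp add: cmod_power2 ellipse_velocity_def power_mult_distrib)
  then have n_pos: "0 < ?n"
    using speed_pos[of m] by (metis zero_less_power)
  have "Re (- \<i> * ellipse_velocity t / (ellipse_point t - ellipse_point u))
      = Im (ellipse_velocity t / ellipse_velocity m) / (2 * sin h)"
  proof -
    have e: "- \<i> * ellipse_velocity t / (ellipse_point t - ellipse_point u)
        = - \<i> * (ellipse_velocity t / ellipse_velocity m) / of_real (2 * sin h)"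
      by (simp add: chord scaleR_conv_of_real)
    have "Re (- \<i> * w) = Im w" for w by simp
    then show ?thesis
      unfolding e Re_divide_of_real by (simp only:)
  qed
  also have "Im (ellipse_velocity t / ellipse_velocity m) = a * b * sin h / ?n"
  proof -
    have "Im (ellipse_velocity t) * Re (ellipse_velocity m) - Re (ellipse_velocity t) * Im (ellipse_velocity m)
        = a * b * sin h * ((sin m)\<^sup>2 + (cos m)\<^sup>2)"
      unfolding ellipse_velocity_def complex.sel tu(1) cos_add sin_add by algebra
    then show ?thesis
      by (simp add: Im_divide flip: n cmod_power2)
  qed
  finally have "1 / pi * Re (- \<i> * ellipse_velocity t / (ellipse_point t - ellipse_point u))
      = a * b / (2 * pi * ?n)"
    using nz by simp
  also have "\<dots> = poisson radius (t + u)"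
  proof -
    have s: "(a + b)\<^sup>2 \<noteq> 0" "a + b \<noteq> 0" using pos by auto
    have "1 - radius\<^sup>2 = 4 * a * b / (a + b)\<^sup>2"
      unfolding radius_def using s by (simp add: power_divide divide_simps) algebra
    moreover have "1 - 2 * radius * cos (2 * m) + radius\<^sup>2 = 4 * ?n / (a + b)\<^sup>2"
    proof -
      have "(a + b)\<^sup>2 * (1 - 2 * radius * cos (2 * m) + radius\<^sup>2)
          = (a + b)\<^sup>2 - 2 * (a - b) * (a + b) * cos (2 * m) + (a - b)\<^sup>2"
      proof -
        have "(a + b) * radius = a - b"
          using s by (simp add: radius_def)
        then show ?thesis by algebra
      qed
      also have "\<dots> = 4 * ?n"
        using sin_cos_squared_add[of m] unfolding cos_double by algebra
      finally show ?thesis using s by (simp add: field_simps)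
    qed
    ultimately have "poisson radius (t + u) = 4 * a * b / (a + b)\<^sup>2 / (2 * pi * (4 * ?n / (a + b)\<^sup>2))"
      by (simp only: poisson_def tu(3))
    also have "\<dots> = a * b / (2 * pi * ?n)"
    proof -
      have "4 * a * b / x / (2 * pi * (4 * y / x)) = a * b / (2 * pi * y)" if "x \<noteq> 0" for x y
        using that by simp
      from this[OF s(1)] show ?thesis .
    qed
    finally show ?thesis by simp
  qed
  finally show ?thesis .
qed

lemma arclength_param_bdry: "arclength_param \<Omega> (perimeter \<Omega>) (bdry \<Omega>)"
proof -
  have "\<exists>\<gamma>. arclength_param \<Omega> (perimeter \<Omega>) \<gamma>"
    unfolding perimeter_def by (rule someI_ex[OF ellipse_arclength_param_exists])
  then show ?thesis
    unfolding bdry_def by (rule someI_ex)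
qed

lemma perimeter_pos: "0 < perimeter \<Omega>"
  and inj_bdry: "inj_on (bdry \<Omega>) {0..<perimeter \<Omega>}"
  and bdry_image: "bdry \<Omega> ` {0..<perimeter \<Omega>} = frontier \<Omega>"
  using arclength_param_bdry by (simp_all add: arclength_param_def)

lemma tangent_ellipse:
  "tangent_in \<Omega> (ellipse_point t) = ellipse_velocity t /\<^sub>R speed t"
  "tangent_out \<Omega> (ellipse_point t) = ellipse_velocity t /\<^sub>R speed t"
proof -
  obtain \<phi> where \<phi>: "\<And>s. bdry \<Omega> s = ellipse_point (\<phi> s)"
    and deriv: "\<And>s. (\<phi> has_real_derivative 1 / speed (\<phi> s)) (at s)"
    by (rule arclength_param_phase[OF arclength_param_bdry]) blast
  define s where "s = bdry_pos \<Omega> (ellipse_point t)"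
  have "ellipse_point t \<in> bdry \<Omega> ` {0..<perimeter \<Omega>}"
    unfolding bdry_image frontier_ellipse by simp
  then have "ellipse_point (\<phi> s) = ellipse_point t"
    unfolding \<phi>[symmetric] s_def bdry_pos_def by (rule f_inv_into_f)
  \<comment> \<open>The angles \<open>\<phi> s\<close> and \<open>t\<close> may differ by a multiple
    of \<open>2 * pi\<close>, but the velocity depends on the point only.\<close>
  then have v: "ellipse_velocity (\<phi> s) = ellipse_velocity t"
    using pos by (simp add: ellipse_point_def ellipse_velocity_def)
  have "(ellipse_point \<circ> \<phi> has_vector_derivative (1 / speed (\<phi> s)) *\<^sub>R ellipse_velocity (\<phi> s)) (at s)"
    using deriv[of s] ellipse_point_deriv
    by (intro vector_diff_chain_at) (simp_all add: has_real_derivative_iff_has_vector_derivative)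
  moreover have "ellipse_point \<circ> \<phi> = bdry \<Omega>"
    by (auto simp: \<phi>)
  ultimately have "(bdry \<Omega> has_vector_derivative ellipse_velocity t /\<^sub>R speed t) (at s within S)" for S
    by (simp add: v inverse_eq_divide has_vector_derivative_at_within)
  \<comment> \<open>\<open>vector_derivative\<close> is a choice of derivative, which is unique
    along a half-line because these filters are nontrivial.\<close>
  moreover have "at s within {..s} \<noteq> bot" "at s within {s..} \<noteq> bot"
  proof -
    have "{..s} - {s} = {..<s}" "{s..} - {s} = {s<..}" by auto
    then show "at s within {..s} \<noteq> bot" "at s within {s..} \<noteq> bot"
      by (simp_all add: at_within_eq_bot_iff)
  qed
  ultimately show "tangent_in \<Omega> (ellipse_point t) = ellipse_velocity t /\<^sub>R speed t"
    "tangent_out \<Omega> (ellipse_point t) = ellipse_velocity t /\<^sub>R speed t"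
    unfolding tangent_in_def tangent_out_def s_def[symmetric] by (simp_all add: vector_derivative_within)
qed

text \<open>Both one-sided tangents agree, and \<open>Arg2pi 1 = 0\<close>. So there are no corners
  and the point mass has weight 0.\<close>

lemma alpha_plus_ellipse: "alpha_plus \<Omega> (ellipse_point t) = alpha_minus \<Omega> (ellipse_point t)"
proof -
  have "ellipse_velocity t /\<^sub>R speed t \<noteq> 0"
    using speed_pos[of t] by auto
  then show ?thesis
    using Arg2pi_of_real[of 1] by (simp add: alpha_plus_def tangent_ellipse)
qed

lemma NP_density_ellipse:
  "NP_density \<Omega> (ellipse_point u) (ellipse_point t)
    = (if ellipse_point t = ellipse_point u then 0 else poisson radius (t + u) / speed t)"
proof (cases "ellipse_point t = ellipse_point u")
  case False
  have "outward_normal \<Omega> (ellipse_point t) / (ellipse_point t - ellipse_point u)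
      = (- \<i> * ellipse_velocity t / (ellipse_point t - ellipse_point u)) /\<^sub>R speed t"
    by (simp add: outward_normal_def tangent_ellipse scaleR_conv_of_real divide_inverse mult_ac)
  then have "NP_density \<Omega> (ellipse_point u) (ellipse_point t)
      = 1 / pi * Re ((- \<i> * ellipse_velocity t / (ellipse_point t - ellipse_point u)) /\<^sub>R speed t)"
    using False by (simp only: NP_density_def corner_def alpha_plus_ellipse) simp
  also have "\<dots> = 1 / pi * Re (- \<i> * ellipse_velocity t / (ellipse_point t - ellipse_point u)) / speed t"
    by (simp only: scaleR_complex.sel divide_inverse mult_ac)
  finally show ?thesis
    using False by (simp only: kernel_eq_poisson[OF False]) simp
qed (simp add: NP_density_def)

lemma NP_density_nonneg: "\<sigma> \<in> frontier \<Omega> \<Longrightarrow> 0 \<le> NP_density \<Omega> (ellipse_point u) \<sigma>"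
  using poisson_pos[OF abs_radius_less_one] by (auto simp: frontier_ellipse NP_density_ellipse less_imp_le)

text \<open>The density is built from choice operators, so it is compared on the frontier with an
  explicit measurable function.\<close>

lemma NP_density_measurable:
  "NP_density \<Omega> (ellipse_point u) \<in> borel_measurable (restrict_space borel (frontier \<Omega>))"
proof -
  \<comment> \<open>The velocity rewritten in the coordinates of the point, through
    \<open>Re \<sigma> = a * cos t\<close> and \<open>Im \<sigma> = b * sin t\<close>.\<close>
  define V where "V \<sigma> = Complex (- a / b * Im \<sigma>) (b / a * Re \<sigma>)" for \<sigma>
  have V: "V (ellipse_point t) = ellipse_velocity t" for t
    using pos by (simp add: V_def ellipse_point_def ellipse_velocity_def)
  define g where "g \<sigma> = (if \<sigma> = ellipse_point u then 0
    else 1 / pi * Re (- \<i> * (V \<sigma> /\<^sub>R cmod (V \<sigma>)) / (\<sigma> - ellipse_point u)))" for \<sigma>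
  have "continuous_on UNIV V"
    unfolding V_def by (intro continuous_intros)
  then have [measurable]: "V \<in> borel_measurable borel"
    by (rule borel_measurable_continuous_onI)
  have "g \<in> borel_measurable borel"
    unfolding g_def by measurable
  then have "g \<in> borel_measurable (restrict_space borel (frontier \<Omega>))"
    by (rule measurable_restrict_space1)
  moreover have "g \<sigma> = NP_density \<Omega> (ellipse_point u) \<sigma>" if "\<sigma> \<in> frontier \<Omega>" for \<sigma>
    using that by (auto simp: frontier_ellipse g_def NP_density_def corner_def alpha_plus_ellipse outward_normal_def tangent_ellipse V)
  ultimately show ?thesis
    by (subst measurable_cong[symmetric]) (auto simp: space_restrict_space)
qed

lemma NP_measure_ellipse:
  "NP_measure \<Omega> (ellipse_point u)
    = density (arclength_measure \<Omega>) (\<lambda>\<sigma>. ennreal (NP_density \<Omega> (ellipse_point u) \<sigma>))"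
  unfolding NP_measure_def density_def
  by (simp add: interior_angle_def alpha_plus_ellipse arclength_measure_def space_restrict_space)

text \<open>The substitution \<open>t = \<phi> s\<close> has derivative 1/speed, which is exactly
  the factor by which the arclength density differs from the Poisson kernel.\<close>

lemma NP_operator_ellipse:
  assumes f: "continuous_on (frontier \<Omega>) f"
  shows "NP_operator \<Omega> f (ellipse_point u)
    = integral {0..2 * pi} (\<lambda>t. poisson radius (t + u) *\<^sub>R f (ellipse_point t))"
proof -
  let ?L = "perimeter \<Omega>" and ?\<gamma> = "bdry \<Omega>" and ?\<rho> = "NP_density \<Omega> (ellipse_point u)"
  let ?B = "restrict_space borel (frontier \<Omega>)"
  let ?I = "restrict_space lborel {0..<perimeter \<Omega>}"
  obtain \<phi> where \<gamma>: "\<And>s. ?\<gamma> s = ellipse_point (\<phi> s)"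
    and deriv: "\<And>s. (\<phi> has_real_derivative 1 / speed (\<phi> s)) (at s)"
    and per: "\<And>s. \<phi> (s + ?L) = \<phi> s + 2 * pi"
    by (rule arclength_param_phase[OF arclength_param_bdry]) blast
  define h where "h t = poisson radius (t + u) *\<^sub>R f (ellipse_point t)" for t
  define g where "g s = (1 / speed (\<phi> s)) *\<^sub>R h (\<phi> s)" for s
  have cont_h: "continuous_on S h" for S
    unfolding h_def
    by (intro continuous_intros continuous_on_compose2[OF f] continuous_on_poisson[OF abs_radius_less_one])
       (auto simp: frontier_ellipse)
  have cont_\<phi>: "continuous_on S \<phi>" for S
    by (intro continuous_at_imp_continuous_on ballI DERIV_isCont[OF deriv])
  have cont_g: "continuous_on S g" for S
    unfolding g_def using speed_pos
    by (intro continuous_intros continuous_on_compose2[OF cont_h] cont_\<phi>) (auto simp: less_imp_neq[symmetric])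
  have [measurable]: "?\<gamma> \<in> measurable ?I ?B"
  proof (rule measurable_restrict_space2)
    have "?\<gamma> \<in> borel_measurable borel"
      by (intro borel_measurable_continuous_onI arclength_param_continuous[OF arclength_param_bdry])
    then show "?\<gamma> \<in> borel_measurable ?I"
      by (intro measurable_restrict_space1) simp
  qed (auto simp: \<gamma> frontier_ellipse)
  have [measurable]: "f \<in> borel_measurable ?B"
    by (rule borel_measurable_continuous_on_restrict[OF f])
  note [measurable] = NP_density_measurable[of u]
  have sets: "sets (arclength_measure \<Omega>) = sets ?B"
    by (simp add: arclength_measure_def)
  have "NP_operator \<Omega> f (ellipse_point u) = (\<integral>\<sigma>. ?\<rho> \<sigma> *\<^sub>R f \<sigma> \<partial>arclength_measure \<Omega>)"
    unfolding NP_operator_def NP_measure_ellipse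
  proof (rule integral_density)
    show "AE \<sigma> in arclength_measure \<Omega>. 0 \<le> ?\<rho> \<sigma>"
      by (rule AE_I2) (simp add: NP_density_nonneg arclength_measure_def space_restrict_space)
  qed (simp_all add: measurable_cong_sets[OF sets refl] NP_density_measurable)
  also have "\<dots> = (\<integral>s. ?\<rho> (?\<gamma> s) *\<^sub>R f (?\<gamma> s) \<partial>?I)"
    unfolding arclength_measure_def by (rule integral_distr) measurable
  also have "\<dots> = (\<integral>s. g s \<partial>?I)"
  proof (rule integral_cong_AE)
    show "g \<in> borel_measurable ?I"
      using borel_measurable_continuous_onI[OF cont_g] by (intro measurable_restrict_space1) simp
    \<comment> \<open>At the point itself the density is set to 0, while \<open>g\<close> keeps the
      Poisson value. By injectivity of the boundary curve this concerns a single parameter.\<close>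
    have "AE s in lborel. s \<noteq> bdry_pos \<Omega> (ellipse_point u)"
      by (rule AE_lborel_singleton)
    then have "AE s in lborel. s \<in> {0..<?L} \<longrightarrow> ?\<rho> (?\<gamma> s) *\<^sub>R f (?\<gamma> s) = g s"
    proof (rule AE_mp, intro AE_I2 impI)
      fix s assume "s \<noteq> bdry_pos \<Omega> (ellipse_point u)" "s \<in> {0..<?L}"
      then have "?\<gamma> s \<noteq> ellipse_point u"
        using inv_into_f_f[OF inj_bdry, of s] by (auto simp: bdry_pos_def)
      then show "?\<rho> (?\<gamma> s) *\<^sub>R f (?\<gamma> s) = g s"
        by (simp add: \<gamma> NP_density_ellipse g_def h_def)
    qed
    then show "AE s in ?I. ?\<rho> (?\<gamma> s) *\<^sub>R f (?\<gamma> s) = g s"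
      by (simp add: AE_restrict_space_iff)
  qed measurable
  also have "\<dots> = (LINT s:{0..<?L}|lborel. g s)"
    unfolding set_lebesgue_integral_def by (rule integral_restrict_space) simp
  also have "\<dots> = integral {0..<?L} g"
  proof (rule set_borel_integral_eq_integral(2))
    have "set_integrable lborel {0..?L} g"
      by (rule borel_integrable_atLeastAtMost'[OF cont_g])
    then show "set_integrable lborel {0..<?L} g"
      by (rule set_integrable_subset) auto
  qed
  also have "\<dots> = integral {0..?L} g"
  proof (rule integral_subset_negligible)
    have "{0..?L} - {0..<?L} \<subseteq> {?L}" by auto
    then show "negligible ({0..?L} - {0..<?L})"
      by (rule negligible_subset[OF negligible_sing])
  qed auto
  also have "\<dots> = integral {\<phi> 0..\<phi> ?L} h"
  proof (rule integral_unique)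
    have mono: "\<phi> s \<le> \<phi> t" if "s \<le> t" for s t
      by (rule DERIV_nonneg_imp_nondecreasing[OF that]) (use deriv in force)
    have "((\<lambda>s. (1 / speed (\<phi> s)) *\<^sub>R h (\<phi> s)) has_integral integral {\<phi> 0..\<phi> ?L} h) {0..?L}"
    proof (rule has_integral_substitution)
      show "\<phi> ` {0..?L} \<subseteq> {\<phi> 0..\<phi> ?L}" using mono by auto
    qed (use perimeter_pos mono cont_h deriv in \<open>auto intro: has_field_derivative_at_within\<close>)
    then show "(g has_integral integral {\<phi> 0..\<phi> ?L} h) {0..?L}"
      by (simp only: g_def[abs_def])
  qed
  \<comment> \<open>The starting angle \<open>\<phi> 0\<close> is unknown, as the curve is chosen
    only up to a shift; periodicity moves the period to a fixed interval.\<close>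
  also have "\<dots> = integral {0..2 * pi} h"
  proof -
    have "h (t + 2 * pi) = h t" for t
    proof -
      have "poisson radius (t + 2 * pi + u) = poisson radius (t + u)"
        using poisson_periodic[OF abs_radius_less_one, of "t + u"] by (simp add: algebra_simps)
      then show ?thesis
        by (simp add: h_def ellipse_point_def)
    qed
    then show ?thesis
      using integral_periodic_shift(2)[OF cont_h, of "2 * pi" "\<phi> 0"] per[of 0] by simp
  qed
  finally show ?thesis by (simp only: h_def[abs_def])
qed

end

section \<open>The configuration constant\<close>

text \<open>Suprema and infima of reals are informative only for bounded sets: the bound for one
  constant \<open>c\<close> yields bounds for every other, so that all suprema are nonnegative and
  the infimum is over a set bounded below.\<close>

lemma quotient_norm_le:
  assumes "\<And>\<zeta>. \<zeta> \<in> frontier \<Omega> \<Longrightarrow> cmod (g \<zeta> - c) \<le> C" "frontier \<Omega> \<noteq> {}"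
  shows "quotient_norm \<Omega> g \<le> C"
proof -
  obtain \<zeta> where \<zeta>: "\<zeta> \<in> frontier \<Omega>" using assms(2) by blast
  have "cmod (g \<xi> - d) \<le> C + cmod (c - d)" if "\<xi> \<in> frontier \<Omega>" for \<xi> d
    using assms(1)[OF that] norm_triangle_ineq[of "g \<xi> - c" "c - d"] by simp
  then have "0 \<le> (SUP \<zeta>\<in>frontier \<Omega>. cmod (g \<zeta> - d))" for d
    by (intro cSUP_upper2[OF _ \<zeta>]) (auto intro!: bdd_aboveI2)
  then have "quotient_norm \<Omega> g \<le> (SUP \<zeta>\<in>frontier \<Omega>. cmod (g \<zeta> - c))"
    unfolding quotient_norm_def by (intro cINF_lower bdd_belowI2) auto
  also have "\<dots> \<le> C"
    using assms by (intro cSUP_least)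
  finally show ?thesis .
qed

lemma bdd_above_norm_diff:
  assumes "bounded (g ` S)"
  shows "bdd_above ((\<lambda>\<zeta>. cmod (g \<zeta> - c)) ` S)"
proof -
  obtain B where B: "\<And>\<zeta>. \<zeta> \<in> S \<Longrightarrow> cmod (g \<zeta>) \<le> B"
    using assms by (auto simp: bounded_iff)
  have "cmod (g \<zeta> - c) \<le> B + cmod c" if "\<zeta> \<in> S" for \<zeta>
    using B[OF that] norm_triangle_ineq4[of "g \<zeta>" c] by linarith
  then show ?thesis by (intro bdd_aboveI2)
qed

lemma quotient_norm_ge:
  assumes "bounded (g ` frontier \<Omega>)" "\<zeta> \<in> frontier \<Omega>" "\<xi> \<in> frontier \<Omega>"
  shows "cmod (g \<zeta> - g \<xi>) / 2 \<le> quotient_norm \<Omega> g"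
  unfolding quotient_norm_def
proof (rule cINF_greatest)
  fix c
  have "cmod (g \<zeta> - c) \<le> (SUP \<zeta>\<in>frontier \<Omega>. cmod (g \<zeta> - c))"
    "cmod (g \<xi> - c) \<le> (SUP \<zeta>\<in>frontier \<Omega>. cmod (g \<zeta> - c))"
    using assms by (auto intro!: cSUP_upper bdd_above_norm_diff)
  then show "cmod (g \<zeta> - g \<xi>) / 2 \<le> (SUP \<zeta>\<in>frontier \<Omega>. cmod (g \<zeta> - c))"
    using norm_triangle_ineq4[of "g \<zeta> - c" "g \<xi> - c"] by simp
qed simp

lemma quotient_norm_lessD:
  assumes "bounded (g ` frontier \<Omega>)" "quotient_norm \<Omega> g < C"
  obtains c where "\<And>\<zeta>. \<zeta> \<in> frontier \<Omega> \<Longrightarrow> cmod (g \<zeta> - c) \<le> C"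
proof -
  obtain c where c: "(SUP \<zeta>\<in>frontier \<Omega>. cmod (g \<zeta> - c)) < C"
    using cInf_lessD[OF _ assms(2)[unfolded quotient_norm_def]] by auto
  have "cmod (g \<zeta> - c) \<le> C" if "\<zeta> \<in> frontier \<Omega>" for \<zeta>
    using cSUP_upper[OF that bdd_above_norm_diff[OF assms(1)], of c] c by linarith
  then show ?thesis by (rule that)
qed

section \<open>Upper and lower bounds for the ellipse\<close>

context ellipse_axes
begin

abbreviation "P \<equiv> poisson radius"

abbreviation "c\<^sub>0 \<equiv> poisson_bound radius"

lemmas continuous_on_P = continuous_on_poisson[OF abs_radius_less_one]

lemma poisson_bound_radius: "c\<^sub>0 = 2 / pi * arctan (1 / 2 * \<bar>b / a - a / b\<bar>)"
proof -
  have s: "a + b \<noteq> 0" "a \<noteq> 0" "b \<noteq> 0" using pos by auto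
  have "1 - radius\<^sup>2 = 4 * a * b / (a + b)\<^sup>2"
    unfolding radius_def using s by (simp add: power_divide divide_simps) algebra
  then have "2 * radius / (1 - radius\<^sup>2) = - (1 / 2 * (b / a - a / b))"
    using s by (simp add: radius_def divide_simps) (simp add: power2_eq_square algebra_simps)
  then have "\<bar>2 * radius / (1 - radius\<^sup>2)\<bar> = 1 / 2 * \<bar>b / a - a / b\<bar>"
    by (simp add: abs_mult)
  moreover have "\<bar>2 * radius / (1 - radius\<^sup>2)\<bar> = 2 * \<bar>radius\<bar> / (1 - radius\<^sup>2)"
    using square_less_one[OF abs_radius_less_one] by (simp add: abs_mult)
  ultimately show ?thesis
    unfolding poisson_bound_def[OF abs_radius_less_one] by (simp only:)
qed

lemma poisson_bound_radius_nonneg: "0 \<le> c\<^sub>0"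
  unfolding poisson_bound_radius by simp

lemma ellipse_point_reduce: "\<exists>t\<in>{0..2 * pi}. ellipse_point u = ellipse_point t"
proof -
  define n where "n = \<lfloor>u / (2 * pi)\<rfloor>"
  have "u - of_int n * (2 * pi) \<in> {0..2 * pi}"
    using floor_divide_lower[of "2 * pi" u] floor_divide_upper[of "2 * pi" u]
    by (auto simp: n_def algebra_simps)
  moreover have "ellipse_point u = ellipse_point (u - of_int n * (2 * pi))"
    by (auto simp: ellipse_point_eq_iff intro!: exI[of _ n])
  ultimately show ?thesis by blast
qed

lemma compact_frontier_ellipse: "compact (frontier \<Omega>)"
proof -
  have "frontier \<Omega> = ellipse_point ` {0..2 * pi}"
    using ellipse_point_reduce by (fastforce simp: frontier_ellipse)
  then show ?thesis
    by (auto intro!: compact_continuous_image continuous_intros)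
qed

lemma bounded_continuous_image:
  "continuous_on (frontier \<Omega>) f \<Longrightarrow> bounded (f ` frontier \<Omega>)"
  by (intro compact_imp_bounded compact_continuous_image compact_frontier_ellipse)

text \<open>The kernel has mass 1, so \<open>\<mu>\<close> can be subtracted first. A zero-sum
  combination of values of the operator then pairs a zero-sum combination of kernels with a function
  of modulus at most \<open>M\<close>, and the L1 bound supplies the hypothesis of
  \<open>common_centre\<close>.\<close>

lemma NP_operator_enclosing_disc:
  assumes f: "continuous_on (frontier \<Omega>) f"
    and bound: "\<And>\<zeta>. \<zeta> \<in> frontier \<Omega> \<Longrightarrow> cmod (f \<zeta> - \<mu>) \<le> M"
  obtains z where "\<And>\<zeta>. \<zeta> \<in> frontier \<Omega> \<Longrightarrow> cmod (NP_operator \<Omega> f \<zeta> - z) \<le> c\<^sub>0 * M"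
proof -
  define F where "F t = f (ellipse_point t) - \<mu>" for t
  define G where "G u = integral {0..2 * pi} (\<lambda>t. P (t + u) *\<^sub>R f (ellipse_point t))" for u
  have point: "ellipse_point t \<in> frontier \<Omega>" for t
    by (simp add: frontier_ellipse)
  have M: "cmod (F t) \<le> M" for t
    using bound[OF point] by (simp add: F_def)
  have M0: "0 \<le> M" using M[of 0] norm_ge_zero[of "F 0"] by linarith
  have cont_f: "continuous_on S (\<lambda>t. f (ellipse_point t))" for S :: "real set"
    by (rule continuous_on_compose2[OF f]) (auto intro!: continuous_intros simp: point)
  have cont_F: "continuous_on S F" for S
    unfolding F_def by (intro continuous_intros cont_f)
  have G_eq: "G u = \<mu> + integral {0..2 * pi} (\<lambda>t. P (t + u) *\<^sub>R F t)" for u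
  proof -
    have "((\<lambda>t. P (t + u) *\<^sub>R \<mu>) has_integral 1 *\<^sub>R \<mu>) {0..2 * pi}"
      by (rule has_integral_scaleR_left[OF poisson_integral[OF abs_radius_less_one]])
    moreover have "(\<lambda>t. P (t + u) *\<^sub>R F t) integrable_on {0..2 * pi}"
      by (intro integrable_continuous_interval continuous_intros continuous_on_P cont_F)
    ultimately have "((\<lambda>t. P (t + u) *\<^sub>R \<mu> + P (t + u) *\<^sub>R F t) has_integral
        1 *\<^sub>R \<mu> + integral {0..2 * pi} (\<lambda>t. P (t + u) *\<^sub>R F t)) {0..2 * pi}"
      by (intro has_integral_add integrable_integral)
    moreover have "P (t + u) *\<^sub>R \<mu> + P (t + u) *\<^sub>R F t = P (t + u) *\<^sub>R f (ellipse_point t)" for t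
      by (simp add: F_def scaleR_diff_right)
    ultimately show ?thesis
      unfolding G_def by (simp add: integral_unique)
  qed
  have cont_G: "continuous_on {0..2 * pi} G"
  proof -
    have "continuous_on ({0..2 * pi} \<times> cbox 0 (2 * pi)) (\<lambda>(u, t). P (t + u) *\<^sub>R f (ellipse_point t))"
      unfolding split_beta
      by (intro continuous_intros continuous_on_P continuous_on_compose2[OF cont_f[of UNIV]]) auto
    from integral_continuous_on_param[OF this] show ?thesis
      by (simp add: G_def[abs_def])
  qed
  obtain z where z: "\<And>w. w \<in> G ` {0..2 * pi} \<Longrightarrow> cmod (w - z) \<le> c\<^sub>0 * M"
  proof (rule common_centre)
    show "compact (G ` {0..2 * pi})"
      by (intro compact_continuous_image cont_G) simp
    show "0 \<le> c\<^sub>0 * M"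
      using poisson_bound_radius_nonneg M0 by simp
    fix S :: "complex set" and c :: "complex \<Rightarrow> complex"
    assume S: "finite S" "S \<subseteq> G ` {0..2 * pi}" and c: "sum c S = 0"
    have "\<forall>w\<in>S. \<exists>u. G u = w" using S(2) by blast
    \<comment> \<open>\<open>common_centre\<close> indexes its combinations by values, so one angle
      is chosen for each value.\<close>
    then obtain u where u: "\<And>w. w \<in> S \<Longrightarrow> G (u w) = w" by metis
    define k where "k t = (\<Sum>w\<in>S. c w * P (t + u w))" for t
    have cont_k: "continuous_on T k" for T
      unfolding k_def by (intro continuous_intros continuous_on_P)
    have int: "((\<lambda>t. c w * (P (t + u w) *\<^sub>R F t)) has_integral c w * (w - \<mu>)) {0..2 * pi}" if "w \<in> S" for w
    proof -
      have "(\<lambda>t. P (t + u w) *\<^sub>R F t) integrable_on {0..2 * pi}"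
        by (intro integrable_continuous_interval continuous_intros continuous_on_P cont_F)
      moreover have "integral {0..2 * pi} (\<lambda>t. P (t + u w) *\<^sub>R F t) = w - \<mu>"
        using G_eq[of "u w"] unfolding u[OF that] by (metis add_diff_cancel_left')
      ultimately show ?thesis
        by (metis has_integral_mult_right integrable_integral)
    qed
    have "((\<lambda>t. \<Sum>w\<in>S. c w * (P (t + u w) *\<^sub>R F t)) has_integral (\<Sum>w\<in>S. c w * (w - \<mu>))) {0..2 * pi}"
      by (intro has_integral_sum S int)
    moreover have "(\<Sum>w\<in>S. c w * (P (t + u w) *\<^sub>R F t)) = k t * F t" for t
      by (simp add: k_def sum_distrib_right scaleR_conv_of_real mult.assoc)
    moreover have "(\<Sum>w\<in>S. c w * (w - \<mu>)) = (\<Sum>w\<in>S. c w * w)"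
      by (simp add: right_diff_distrib sum_subtractf c flip: sum_distrib_right)
    ultimately have "(\<Sum>w\<in>S. c w * w) = integral {0..2 * pi} (\<lambda>t. k t * F t)"
      by (simp add: integral_unique)
    also have "cmod \<dots> \<le> integral {0..2 * pi} (\<lambda>t. cmod (k t) * M)"
      using M M0
      by (intro integral_norm_bound_integral integrable_continuous_interval continuous_intros cont_k cont_F)
         (simp add: norm_mult mult_left_mono)
    also have "\<dots> = integral {0..2 * pi} (\<lambda>t. cmod (k t)) * M"
      by simp
    also have "\<dots> \<le> c\<^sub>0 * (\<Sum>w\<in>S. cmod (c w)) * M"
      unfolding k_def
      by (intro mult_right_mono[OF _ M0] zero_sum_L1_bound[OF S(1) c] continuous_intros continuous_on_P
          poisson_L1_distance_le[OF abs_radius_less_one])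
    finally show "cmod (\<Sum>w\<in>S. c w * w) \<le> c\<^sub>0 * M * (\<Sum>w\<in>S. cmod (c w))"
      by (simp add: mult_ac)
  qed blast
  show ?thesis
  proof (rule that)
    fix \<zeta> assume "\<zeta> \<in> frontier \<Omega>"
    then obtain u where "\<zeta> = ellipse_point u"
      by (auto simp: frontier_ellipse)
    with ellipse_point_reduce[of u] obtain t where t: "t \<in> {0..2 * pi}" "\<zeta> = ellipse_point t"
      by auto
    then have "NP_operator \<Omega> f \<zeta> = G t"
      by (simp add: NP_operator_ellipse[OF f] G_def)
    then show "cmod (NP_operator \<Omega> f \<zeta> - z) \<le> c\<^sub>0 * M"
      using z t by simp
  qed
qed

lemma frontier_ellipse_nonempty: "frontier \<Omega> \<noteq> {}"
  by (simp add: frontier_ellipse)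

lemma quotient_norm_NP_operator_le:
  assumes f: "continuous_on (frontier \<Omega>) f" and le: "quotient_norm \<Omega> f \<le> 1"
  shows "quotient_norm \<Omega> (NP_operator \<Omega> f) \<le> c\<^sub>0"
proof (rule field_le_epsilon)
  fix e :: real
  assume e: "0 < e"
  \<comment> \<open>The infimum in the quotient norm is only approached, hence \<open>M > 1\<close>.
    The excess gives \<open>c\<^sub>0 * M \<le> c\<^sub>0 + e\<close>, and adding 1 in the
    denominator covers the circle, where \<open>c\<^sub>0 = 0\<close>.\<close>
  define M where "M = 1 + e / (c\<^sub>0 + 1)"
  have "0 < e / (c\<^sub>0 + 1)"
    using e poisson_bound_radius_nonneg by simp
  then have "quotient_norm \<Omega> f < M"
    using le unfolding M_def by linarith
  then obtain \<mu> where "\<And>\<zeta>. \<zeta> \<in> frontier \<Omega> \<Longrightarrow> cmod (f \<zeta> - \<mu>) \<le> M"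
    using quotient_norm_lessD[OF bounded_continuous_image[OF f]] by blast
  then obtain z where "\<And>\<zeta>. \<zeta> \<in> frontier \<Omega> \<Longrightarrow> cmod (NP_operator \<Omega> f \<zeta> - z) \<le> c\<^sub>0 * M"
    using NP_operator_enclosing_disc[OF f] by blast
  then have "quotient_norm \<Omega> (NP_operator \<Omega> f) \<le> c\<^sub>0 * M"
    by (intro quotient_norm_le frontier_ellipse_nonempty)
  also have "\<dots> = c\<^sub>0 + e * (c\<^sub>0 / (c\<^sub>0 + 1))"
    by (simp add: M_def algebra_simps)
  also have "\<dots> \<le> c\<^sub>0 + e * 1"
    using e poisson_bound_radius_nonneg by (intro add_left_mono mult_left_mono) auto
  finally show "quotient_norm \<Omega> (NP_operator \<Omega> f) \<le> c\<^sub>0 + e" by simp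
qed

text \<open>The extremal functions approximate the sign of the difference of the kernels at the
  two endpoints of the axis of length \<open>2 a\<close>.\<close>

lemma NP_operator_almost_extremal:
  assumes "0 < \<delta>"
  obtains f where "continuous_on (frontier \<Omega>) f" "quotient_norm \<Omega> f \<le> 1"
    "c\<^sub>0 - pi * \<delta> \<le> quotient_norm \<Omega> (NP_operator \<Omega> f)"
proof -
  \<comment> \<open>The Poisson kernel as a function of the cosine. Since \<open>Re z / a\<close> is
    that cosine, the test function is given by a formula in the point, and its continuity needs no
    choice of angle.\<close>
  define q where "q x = (1 - radius\<^sup>2) / (2 * pi * (1 - 2 * radius * x + radius\<^sup>2))" for x
  define d where "d x = q (- x) - q x" for x
  define f where "f z = complex_of_real (d (Re z / a) / (\<bar>d (Re z / a)\<bar> + \<delta>))" for z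
  define D where "D t = P (t + pi) - P t" for t
  have Dd: "d (Re (ellipse_point t) / a) = D t" for t
    using pos by (simp add: d_def q_def D_def poisson_def ellipse_point_def)
  have f_point: "f (ellipse_point t) = complex_of_real (D t / (\<bar>D t\<bar> + \<delta>))" for t
    by (simp add: f_def Dd)
  have f: "continuous_on (frontier \<Omega>) f"
  proof -
    have "1 - 2 * radius * (Re z / a) + radius\<^sup>2 \<noteq> 0"
      "1 - 2 * radius * (- (Re z / a)) + radius\<^sup>2 \<noteq> 0" if "z \<in> frontier \<Omega>" for z
    proof -
      obtain t where "z = ellipse_point t" using \<open>z \<in> frontier \<Omega>\<close> by (auto simp: frontier_ellipse)
      then have "Re z / a = cos t" "- (Re z / a) = cos (t + pi)"
        using pos by (simp_all add: ellipse_point_def)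
      then show "1 - 2 * radius * (Re z / a) + radius\<^sup>2 \<noteq> 0"
        "1 - 2 * radius * (- (Re z / a)) + radius\<^sup>2 \<noteq> 0"
        using poisson_denominator_pos[OF abs_radius_less_one, of t]
          poisson_denominator_pos[OF abs_radius_less_one, of "t + pi"] by auto
    qed
    then have "continuous_on (frontier \<Omega>) (\<lambda>z. d (Re z / a))"
      unfolding d_def q_def using pos by (intro continuous_intros) auto
    then show ?thesis
      unfolding f_def using assms
      by (intro continuous_intros) (auto simp: add_nonneg_pos less_imp_neq[symmetric])
  qed
  have norm_f: "cmod (f z) \<le> 1" for z
    unfolding f_def norm_of_real using assms by (simp add: divide_le_eq_1 add_nonneg_pos)
  have "quotient_norm \<Omega> f \<le> 1"
    by (rule quotient_norm_le[of _ _ 0, OF _ frontier_ellipse_nonempty]) (simp add: norm_f)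
  have cont_f: "continuous_on S (\<lambda>t. f (ellipse_point t))" for S :: "real set"
    by (rule continuous_on_compose2[OF f]) (auto intro!: continuous_intros simp: frontier_ellipse)
  have cont_D: "continuous_on S D" for S
    unfolding D_def by (intro continuous_intros continuous_on_P)
  let ?K = "NP_operator \<Omega> f"
  have "?K (ellipse_point pi) - ?K (ellipse_point 0)
      = integral {0..2 * pi} (\<lambda>t. P (t + pi) *\<^sub>R f (ellipse_point t) - P (t + 0) *\<^sub>R f (ellipse_point t))"
    unfolding NP_operator_ellipse[OF f]
    by (intro integral_diff[symmetric] integrable_continuous_interval continuous_intros continuous_on_P cont_f)
  also have "\<dots> = integral {0..2 * pi} (\<lambda>t. complex_of_real (D t * (D t / (\<bar>D t\<bar> + \<delta>))))"
  proof (intro integral_cong)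
    fix t
    show "P (t + pi) *\<^sub>R f (ellipse_point t) - P (t + 0) *\<^sub>R f (ellipse_point t)
        = complex_of_real (D t * (D t / (\<bar>D t\<bar> + \<delta>)))"
      unfolding f_point scaleR_left.diff[symmetric] add_0_right D_def[symmetric]
      by (simp only: scaleR_conv_of_real of_real_mult)
  qed
  also have "\<dots> = complex_of_real (integral {0..2 * pi} (\<lambda>t. D t * (D t / (\<bar>D t\<bar> + \<delta>))))"
    using assms
    by (intro integral_unique has_integral_of_real integrable_integral integrable_continuous_interval continuous_intros cont_D)
       (auto simp: add_nonneg_pos less_imp_neq[symmetric])
  finally have diff: "?K (ellipse_point pi) - ?K (ellipse_point 0)
      = complex_of_real (integral {0..2 * pi} (\<lambda>t. D t * (D t / (\<bar>D t\<bar> + \<delta>))))" .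
  \<comment> \<open>Replacing the sign of \<open>D\<close> by
    \<open>D / (\<bar>D\<bar> + \<delta>)\<close> costs at most \<open>\<delta>\<close> pointwise,
    hence \<open>2 * pi * \<delta>\<close> in the integral and half of that in the norm.\<close>
  have "2 * c\<^sub>0 - 2 * pi * \<delta> = integral {0..2 * pi} (\<lambda>t. \<bar>D t\<bar>) - integral {0..2 * pi} (\<lambda>t. \<delta>)"
    using poisson_L1_distance_antipodal[OF abs_radius_less_one] by (simp add: D_def)
  also have "\<dots> = integral {0..2 * pi} (\<lambda>t. \<bar>D t\<bar> - \<delta>)"
    by (intro integral_diff[symmetric] integrable_continuous_interval continuous_intros cont_D)
  also have "\<dots> \<le> integral {0..2 * pi} (\<lambda>t. D t * (D t / (\<bar>D t\<bar> + \<delta>)))"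
  proof (intro integral_le)
    show "(\<lambda>t. D t * (D t / (\<bar>D t\<bar> + \<delta>))) integrable_on {0..2 * pi}"
      using assms
      by (intro integrable_continuous_interval continuous_intros cont_D)
         (auto simp: add_nonneg_pos less_imp_neq[symmetric])
    fix t
    have "(\<bar>D t\<bar> - \<delta>) * (\<bar>D t\<bar> + \<delta>) \<le> D t * D t"
      using assms by (simp add: algebra_simps abs_mult_self_eq)
    then show "\<bar>D t\<bar> - \<delta> \<le> D t * (D t / (\<bar>D t\<bar> + \<delta>))"
      using assms by (simp add: pos_le_divide_eq add_nonneg_pos)
  qed (intro integrable_continuous_interval continuous_intros cont_D)
  also have "\<dots> \<le> cmod (?K (ellipse_point pi) - ?K (ellipse_point 0))"
    unfolding diff by simp
  also have "\<dots> / 2 \<le> quotient_norm \<Omega> ?K"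
  \<comment> \<open>The boundedness required here is read off the enclosing disc of the upper bound,
    with centre 0 and bound 1 for \<open>f\<close>.\<close>
  proof (rule quotient_norm_ge)
    obtain z where z: "\<And>\<zeta>. \<zeta> \<in> frontier \<Omega> \<Longrightarrow> cmod (?K \<zeta> - z) \<le> c\<^sub>0 * 1"
      using NP_operator_enclosing_disc[OF f, of 0 1] norm_f by auto
    then show "bounded (?K ` frontier \<Omega>)"
      unfolding bounded_def by (intro exI[of _ z] exI[of _ "c\<^sub>0"]) (auto simp: dist_norm norm_minus_commute)
  qed (simp_all add: frontier_ellipse)
  finally have "c\<^sub>0 - pi * \<delta> \<le> quotient_norm \<Omega> ?K" by simp
  with f \<open>quotient_norm \<Omega> f \<le> 1\<close> show ?thesis by (rule that)
qed

lemma configuration_constant_ellipse: "configuration_constant \<Omega> = c\<^sub>0"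
  unfolding configuration_constant_def
proof (rule antisym)
  let ?F = "{f. continuous_on (frontier \<Omega>) f \<and> quotient_norm \<Omega> f \<le> 1}"
  show "(SUP f\<in>?F. quotient_norm \<Omega> (NP_operator \<Omega> f)) \<le> c\<^sub>0"
  proof (rule cSUP_least)
    show "?F \<noteq> {}"
      by (rule NP_operator_almost_extremal[of 1]) auto
  qed (use quotient_norm_NP_operator_le in blast)
  show "c\<^sub>0 \<le> (SUP f\<in>?F. quotient_norm \<Omega> (NP_operator \<Omega> f))"
  proof (rule field_le_epsilon)
    fix e :: real
    assume "0 < e"
    then have "0 < e / pi" by simp
    then obtain f where f: "f \<in> ?F" "c\<^sub>0 - pi * (e / pi) \<le> quotient_norm \<Omega> (NP_operator \<Omega> f)"
      by (rule NP_operator_almost_extremal) blast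
    have "quotient_norm \<Omega> (NP_operator \<Omega> f) \<le> (SUP f\<in>?F. quotient_norm \<Omega> (NP_operator \<Omega> f))"
      using f(1) by (intro cSUP_upper bdd_aboveI2) (use quotient_norm_NP_operator_le in blast)+
    with f(2) show "c\<^sub>0 \<le> (SUP f\<in>?F. quotient_norm \<Omega> (NP_operator \<Omega> f)) + e" by simp
  qed
qed

end

theorem proposition21:
  fixes a b :: real
  assumes "a > 0" and "b > 0"
  shows "configuration_constant (ellipse a b) = 2 / pi * arctan (1 / 2 * \<bar>b / a - a / b\<bar>)"
proof -
  interpret ellipse_axes a b by unfold_locales (use assms in auto)
  show ?thesis
    using configuration_constant_ellipse poisson_bound_radius by simp
qed

end
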